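(* Fix a time step $n$ and let $\varphi_h^{n-1}\in Q_h$, $\boldsymbol u_h^{n-1}\in\boldsymbol V_h$ be given. Let $$\mathcal H_\tau^n(s_h,\boldsymbol w_h):=\frac{\|s_h-\varphi_h^{n-1}-\tau R^n\|_{Q_{h,m}^*}^2}{2\tau}+\mathcal E_c(s_h,\boldsymbol w_h)-\frac{\gamma}{\ell}\left(\Psi_e'(\varphi_h^{n-1}),s_h\right)-(\boldsymbol f^n,\boldsymbol w_h),$$ $$\mathcal E_c(s_h,\boldsymbol w_h):=\int_\Omega\frac{\gamma}{\ell}\Psi_c(s_h)+\gamma\ell\frac{|\nabla s_h|^2}{2}+\frac12\left(\boldsymbol\varepsilon(\boldsymbol w_h)-\xi s_h\boldsymbol I\right):\mathbb C\left(\boldsymbol\varepsilon(\boldsymbol w_h)-\xi s_h\boldsymbol I\right)dx,$$ on $\bar Q_h^n\times\boldsymbol V_h$, where $\bar Q_h^n:=\{s_h\in Q_h:\int_\Omega\frac{s_h-\varphi_h^{n-1}}{\tau}dx=\int_\Omega R^n\,dx\}$, and let $(\varphi_h^n,\boldsymbol u_h^n)\in\bar Q_h^n\times\boldsymbol V_h$ be the minimizer of $\mathcal H_\tau^n$ over $\bar Q_h^n\times\boldsymbol V_h$. Consider the alternating minimization algorithm: $\varphi_h^{n,0}=\varphi_h^{n-1}$, $\boldsymbol u_h^{n,0}=\boldsymbol u_h^{n-1}$, and for each iteration $i\ge1$ $$\varphi_h^{n,i}=\arg\min_{s_h\in\bar Q_h^n}\mathcal H_\tau^n(s_h,\boldsymbol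 u_h^{n,i-1}),\qquad \boldsymbol u_h^{n,i}=\arg\min_{\boldsymbol w_h\in\boldsymbol V_h}\mathcal H_\tau^n(\varphi_h^{n,i},\boldsymbol w_h).$$ Then the algorithm converges linearly in the sense that, for every iteration $i\ge1$, $$\mathcal H_\tau^n(\varphi_h^{n,i},\boldsymbol u_h^{n,i})-\mathcal H_\tau^n(\varphi_h^n,\boldsymbol u_h^n)\le\left(1-\frac{\beta_{\mathrm{ch}}}{L_{\mathrm{ch}}}\right)(1-\beta_{\mathrm e})\left(\mathcal H_\tau^n(\varphi_h^{n,i-1},\boldsymbol u_h^{n,i-1})-\mathcal H_\tau^n(\varphi_h^n,\boldsymbol u_h^n)\right),$$ where $$\beta_{\mathrm{ch}}=\beta_{\mathrm e}=1-\left(\frac{h^2}{\tau C_{\mathrm{inv}}^2\xi^2\boldsymbol I:\mathbb C\boldsymbol I}+\frac{\gamma\ell}{C_\Omega^2\xi^2\boldsymbol I:\mathbb C\boldsymbol I}+1\right)^{-1},$$ $$L_{\mathrm{ch}}=1+L_{\Psi_c}\left(\frac{h^2}{\tau C_{\mathrm{inv}}^2}+\frac{\gamma\ell}{C_\Omega^2}+\xi^2\boldsymbol I:\mathbb C\boldsymbol I\right)^{-1}.$$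
   Context: Domain and spaces: $\Omega\subset\mathbb R^d$ is a bounded (connected) domain with Lipschitz boundary. $Q_h\subseteq H^1(\Omega)$ and $\boldsymbol V_h\subseteq (H^1_0(\Omega))^d$ are conforming finite element spaces (finite-dimensional spaces of piecewise polynomial functions; $Q_h$ contains the constants) with mesh diameter $h>0$. $(\cdot,\cdot)$ is the $L^2(\Omega)$ inner product of scalar or vector functions, $(\cdot;\cdot)$ the $L^2(\Omega)$ inner product of second-order tensor functions, $:$ the pointwise contraction of second-order tensors. $\boldsymbol I$ is the identity tensor in $\mathbb R^{d\times d}$ and $\boldsymbol\varepsilon(\boldsymbol u)=\frac12(\nabla\boldsymbol u+\nabla\boldsymbol u^\top)$. Parameters and data: constants $\gamma,\ell,\tau,m>0$ (with $\tau$ the time-step size), $\xi\in\mathbb R\setminus\{0\}$; $R^n\in L^2(\Omega)$, $\boldsymbol f^n\in L^2(\Omega)^d$. Dual norm: $Q_{h,0}:=\{q_h\in Q_h:\int_\Omega q_h\,dx=0\}$ with norm $\|q_h\|_{h,m}:=\|m^{1/2}\nabla q_h\|_{L^2(\Omega)}$; its dual space is $Q_{h,m}^*$, with norm $\|s\|_{Q_{h,m}^*}:=\sup_{0\neq q_h\in Q_{h,0}}\langle s,q_h\rangle/\|q_h\|_{h,m}$. An $L^2(\Omega)$ function $s$ is identified with the functional $q_h\mapsto(s,q_h)$. Constants: $C_{\mathrm{inv}}>0$ is a constant such that $C_{\mathrm{inv}}h^{-1}\|s_h\|_{Q_{h,m}^*}\ge\|s_h\|_{L^2(\Omega)}$ for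 all $s_h\in Q_{h,0}$, and $C_\Omega>0$ is the Poincaré constant: $\|s_h\|_{L^2(\Omega)}\le C_\Omega\|\nabla s_h\|_{L^2(\Omega)}$ for all $s_h\in Q_{h,0}$. Assumption on the double-well potential: $\Psi=\Psi_c-\Psi_e$ with $\Psi_c,\Psi_e:\mathbb R\to\mathbb R$ convex and differentiable, and $(\Psi_c'(a)-\Psi_c'(b))(a-b)\le L_{\Psi_c}(a-b)^2$ for all $a,b\in\mathbb R$, for a constant $L_{\Psi_c}$. Assumption on the elasticity tensor: $\mathbb C$ is a constant (phase-field-independent) fourth-order tensor for which there are constants $c_{\mathbb C},C_{\mathbb C}>0$ with $c_{\mathbb C}\|\boldsymbol e\|_{L^2(\Omega)}^2\le(\mathbb C\boldsymbol e;\boldsymbol e)\le C_{\mathbb C}\|\boldsymbol e\|_{L^2(\Omega)}^2$ for all symmetric second-order tensor functions $\boldsymbol e\in L^2(\Omega)$, and $(\boldsymbol e,\boldsymbol w)\mapsto(\mathbb C\boldsymbol e;\boldsymbol w)$ is an inner product (in particular symmetric).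
   Formalization: The bound is proved for every i≥2, but for i=1 only if φ_h^{n-1} lies in Q̄_h^n and u_h^{n-1} minimizes H_τ^n(φ_h^{n-1},·) over V_h; for arbitrary initial data the claim at i=1 is false. *)

theory Defs
  imports "HOL-Analysis.Analysis"
begin

text \<open>
  Functions on \<open>\<Omega>\<close> are total functions on \<open>\<real>\<^sup>d\<close> of which only the values on \<open>\<Omega>\<close> matter, and
  only up to null sets.  Second-order tensors are matrices of type \<open>real^'d^'d\<close>; the library's
  inner product on this type is the contraction \<open>A : B = (\<Sum>i j. A\<^sub>i\<^sub>j B\<^sub>i\<^sub>j)\<close>.
\<close>

section \<open>Lipschitz domains\<close>

text \<open>
  Near every boundary point \<open>p\<close> the set is, in the cylinder with axis \<open>n\<close>, radius \<open>r\<close> and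
  half-height \<open>a\<close>, the part strictly above the graph of a Lipschitz function \<open>g\<close> defined on a
  ball of the hyperplane orthogonal to \<open>n\<close>.
\<close>

definition lipschitz_boundary :: "'a::euclidean_space set \<Rightarrow> bool" where
  "lipschitz_boundary S \<longleftrightarrow>
    (\<forall>p \<in> frontier S. \<exists>n r a L g. norm n = 1 \<and> r > 0 \<and> a > 0 \<and>
       L-lipschitz_on {y. y \<bullet> n = 0 \<and> norm y < r} (g :: 'a \<Rightarrow> real) \<and>
       (\<forall>y. y \<bullet> n = 0 \<and> norm y < r \<longrightarrow> \<bar>g y\<bar> < a \<and>
          (\<forall>t. \<bar>t\<bar> < a \<longrightarrow>
             (p + y + t *\<^sub>R n \<in> S \<longleftrightarrow> g y < t) \<and>
             (p + y + t *\<^sub>R n \<in> frontier S \<longleftrightarrow> g y = t))))"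

definition bounded_lipschitz_domain :: "'a::euclidean_space set \<Rightarrow> bool" where
  "bounded_lipschitz_domain \<Omega> \<longleftrightarrow>
     open \<Omega> \<and> connected \<Omega> \<and> \<Omega> \<noteq> {} \<and> bounded \<Omega> \<and> lipschitz_boundary \<Omega>"

section \<open>Lebesgue and Sobolev spaces\<close>

definition L2 :: "'a::euclidean_space set \<Rightarrow> ('a \<Rightarrow> 'b::euclidean_space) set" where
  "L2 \<Omega> = {f. f \<in> borel_measurable (lebesgue_on \<Omega>) \<and>
                 integrable (lebesgue_on \<Omega>) (\<lambda>x. (norm (f x))\<^sup>2)}"

definition l2_inner ::
  "'a::euclidean_space set \<Rightarrow> ('a \<Rightarrow> 'b::euclidean_space) \<Rightarrow> ('a \<Rightarrow> 'b) \<Rightarrow> real" where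
  "l2_inner \<Omega> f g = (LINT x|lebesgue_on \<Omega>. f x \<bullet> g x)"

definition l2_norm :: "'a::euclidean_space set \<Rightarrow> ('a \<Rightarrow> 'b::euclidean_space) \<Rightarrow> real" where
  "l2_norm \<Omega> f = sqrt (l2_inner \<Omega> f f)"

primrec Ck :: "nat \<Rightarrow> ('a::euclidean_space \<Rightarrow> real) \<Rightarrow> bool" where
  "Ck 0 f \<longleftrightarrow> continuous_on UNIV f"
| "Ck (Suc k) f \<longleftrightarrow> (\<forall>x. f differentiable (at x)) \<and>
                     (\<forall>v. Ck k (\<lambda>x. frechet_derivative f (at x) v))"

definition test_functions :: "'a::euclidean_space set \<Rightarrow> ('a \<Rightarrow> real) set" where
  "test_functions \<Omega> =
     {\<psi>. (\<forall>k. Ck k \<psi>) \<and> compact (closure {x. \<psi> x \<noteq> 0}) \<and> closure {x. \<psi> x \<noteq> 0} \<subseteq> \<Omega>}"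

definition has_weak_grad ::
  "'a::euclidean_space set \<Rightarrow> ('a \<Rightarrow> real) \<Rightarrow> ('a \<Rightarrow> 'a) \<Rightarrow> bool" where
  "has_weak_grad \<Omega> u g \<longleftrightarrow>
     (\<forall>\<psi> \<in> test_functions \<Omega>. \<forall>b \<in> Basis.
        l2_inner \<Omega> u (\<lambda>x. frechet_derivative \<psi> (at x) b) = - l2_inner \<Omega> (\<lambda>x. g x \<bullet> b) \<psi>)"

definition H1 :: "'a::euclidean_space set \<Rightarrow> ('a \<Rightarrow> real) set" where
  "H1 \<Omega> = {u \<in> L2 \<Omega>. \<exists>g \<in> L2 \<Omega>. has_weak_grad \<Omega> u g}"

text \<open>The weak gradient is unique only up to null sets; a representative is chosen.\<close>

definition weak_grad :: "'a::euclidean_space set \<Rightarrow> ('a \<Rightarrow> real) \<Rightarrow> 'a \<Rightarrow> 'a" where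
  "weak_grad \<Omega> u = (SOME g. g \<in> L2 \<Omega> \<and> has_weak_grad \<Omega> u g)"

definition h1_norm :: "'a::euclidean_space set \<Rightarrow> ('a \<Rightarrow> real) \<Rightarrow> real" where
  "h1_norm \<Omega> u = sqrt ((l2_norm \<Omega> u)\<^sup>2 + (l2_norm \<Omega> (weak_grad \<Omega> u))\<^sup>2)"

definition H10 :: "'a::euclidean_space set \<Rightarrow> ('a \<Rightarrow> real) set" where
  "H10 \<Omega> = {u \<in> H1 \<Omega>. \<forall>e>0. \<exists>\<psi> \<in> test_functions \<Omega>. h1_norm \<Omega> (\<lambda>x. u x - \<psi> x) < e}"

definition H10_vec :: "(real^'d) set \<Rightarrow> (real^'d \<Rightarrow> real^'d) set" where
  "H10_vec \<Omega> = {w. \<forall>i. (\<lambda>x. w x $ i) \<in> H10 \<Omega>}"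

definition strain :: "(real^'d) set \<Rightarrow> (real^'d \<Rightarrow> real^'d) \<Rightarrow> real^'d \<Rightarrow> real^'d^'d" where
  "strain \<Omega> w x =
     (let G = (\<chi> i j. weak_grad \<Omega> (\<lambda>y. w y $ i) x $ j) in (1/2) *\<^sub>R (G + transpose G))"

section \<open>Finite element spaces\<close>

text \<open>
  A triangulation in the sense of Ciarlet: closed cells with nonempty interior, Lipschitz boundary
  and pairwise disjoint interiors, covering the closure of the domain.
\<close>

definition mesh_of :: "'a::euclidean_space set \<Rightarrow> 'a set set \<Rightarrow> bool" where
  "mesh_of \<Omega> T \<longleftrightarrow> finite T \<and> \<Union>T = closure \<Omega> \<and>
     (\<forall>K \<in> T. interior K \<noteq> {} \<and> K = closure (interior K) \<and> lipschitz_boundary (interior K)) \<and>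
     pairwise (\<lambda>K K'. interior K \<inter> interior K' = {}) T"

definition mesh_diameter :: "'a::euclidean_space set set \<Rightarrow> real" where
  "mesh_diameter T = Max (diameter ` T)"

definition piecewise_polynomial ::
  "'a::euclidean_space set set \<Rightarrow> ('a \<Rightarrow> 'b::euclidean_space) \<Rightarrow> bool" where
  "piecewise_polynomial T s \<longleftrightarrow>
     (\<forall>K \<in> T. \<exists>p. polynomial_function p \<and> (AE x in lebesgue_on K. s x = p x))"

definition fun_span :: "('a \<Rightarrow> 'b::real_vector) set \<Rightarrow> ('a \<Rightarrow> 'b) set" where
  "fun_span B = {(\<lambda>x. \<Sum>b\<in>B. c b *\<^sub>R b x) | c. True}"

definition fe_space ::
  "'a::euclidean_space set set \<Rightarrow> ('a \<Rightarrow> 'b::euclidean_space) set \<Rightarrow> bool" where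
  "fe_space T W \<longleftrightarrow> (\<exists>B. finite B \<and> W = fun_span B) \<and> (\<forall>s \<in> W. piecewise_polynomial T s)"

definition contains_constants ::
  "'a::euclidean_space set \<Rightarrow> ('a \<Rightarrow> real) set \<Rightarrow> bool" where
  "contains_constants \<Omega> Q \<longleftrightarrow> (\<forall>c. \<exists>q \<in> Q. \<forall>x \<in> \<Omega>. q x = c)"

section \<open>The dual norm\<close>

definition mean_zero :: "'a::euclidean_space set \<Rightarrow> ('a \<Rightarrow> real) set \<Rightarrow> ('a \<Rightarrow> real) set" where
  "mean_zero \<Omega> Q = {q \<in> Q. (LINT x|lebesgue_on \<Omega>. q x) = 0}"

definition hm_norm :: "'a::euclidean_space set \<Rightarrow> real \<Rightarrow> ('a \<Rightarrow> real) \<Rightarrow> real" where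
  "hm_norm \<Omega> m q = l2_norm \<Omega> (\<lambda>x. sqrt m *\<^sub>R weak_grad \<Omega> q x)"

text \<open>
  The element \<open>0\<close> only makes the supremum well defined when the mean-zero space is trivial;
  otherwise the set of quotients of a linear functional is symmetric about \<open>0\<close> and its
  supremum is nonnegative anyway.
\<close>

definition dual_norm ::
  "'a::euclidean_space set \<Rightarrow> real \<Rightarrow> ('a \<Rightarrow> real) set \<Rightarrow> (('a \<Rightarrow> real) \<Rightarrow> real) \<Rightarrow> real" where
  "dual_norm \<Omega> m Q F =
     Sup (insert 0 {F q / hm_norm \<Omega> m q | q.
            q \<in> mean_zero \<Omega> Q \<and> \<not> (AE x in lebesgue_on \<Omega>. q x = 0)})"

text \<open>An \<open>L\<^sup>2\<close> function \<open>s\<close> acts as the functional \<open>q \<mapsto> (s, q)\<close>.\<close>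

definition dual_norm_L2 ::
  "'a::euclidean_space set \<Rightarrow> real \<Rightarrow> ('a \<Rightarrow> real) set \<Rightarrow> ('a \<Rightarrow> real) \<Rightarrow> real" where
  "dual_norm_L2 \<Omega> m Q s = dual_norm \<Omega> m Q (\<lambda>q. l2_inner \<Omega> s q)"

section \<open>The elasticity tensor\<close>

definition sym_L2 :: "(real^'d) set \<Rightarrow> (real^'d \<Rightarrow> real^'d^'d) set" where
  "sym_L2 \<Omega> = {e \<in> L2 \<Omega>. \<forall>x \<in> \<Omega>. transpose (e x) = e x}"

definition L2_inner_product_on ::
  "'a::euclidean_space set \<Rightarrow> ('a \<Rightarrow> 'b::euclidean_space) set \<Rightarrow>
     (('a \<Rightarrow> 'b) \<Rightarrow> ('a \<Rightarrow> 'b) \<Rightarrow> real) \<Rightarrow> bool" where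
  "L2_inner_product_on \<Omega> S b \<longleftrightarrow>
     (\<forall>e \<in> S. \<forall>w \<in> S. b e w = b w e) \<and>
     (\<forall>e \<in> S. \<forall>e' \<in> S. \<forall>w \<in> S. \<forall>c c'.
        b (\<lambda>x. c *\<^sub>R e x + c' *\<^sub>R e' x) w = c * b e w + c' * b e' w) \<and>
     (\<forall>e \<in> S. b e e \<ge> 0 \<and> (b e e = 0 \<longrightarrow> (AE x in lebesgue_on \<Omega>. e x = 0)))"

text \<open>
  A constant fourth-order tensor is a linear map on second-order tensors.  Since an elasticity
  tensor may vanish on skew matrices, its form is an inner product on symmetric tensor functions.
\<close>

definition elasticity_tensor ::
  "(real^'d) set \<Rightarrow> (real^'d^'d \<Rightarrow> real^'d^'d) \<Rightarrow> bool" where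
  "elasticity_tensor \<Omega> \<C> \<longleftrightarrow> linear \<C> \<and>
     (\<exists>c C. c > 0 \<and> C > 0 \<and>
        (\<forall>e \<in> sym_L2 \<Omega>. c * (l2_norm \<Omega> e)\<^sup>2 \<le> l2_inner \<Omega> (\<lambda>x. \<C> (e x)) e \<and>
                       l2_inner \<Omega> (\<lambda>x. \<C> (e x)) e \<le> C * (l2_norm \<Omega> e)\<^sup>2)) \<and>
     L2_inner_product_on \<Omega> (sym_L2 \<Omega>) (\<lambda>e w. l2_inner \<Omega> (\<lambda>x. \<C> (e x)) w)"

section \<open>The incremental energy\<close>

definition energy_c ::
  "(real^'d) set \<Rightarrow> real \<Rightarrow> real \<Rightarrow> real \<Rightarrow> (real^'d^'d \<Rightarrow> real^'d^'d) \<Rightarrow> (real \<Rightarrow> real) \<Rightarrow>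
     (real^'d \<Rightarrow> real) \<Rightarrow> (real^'d \<Rightarrow> real^'d) \<Rightarrow> real" where
  "energy_c \<Omega> \<gamma> l \<xi> \<C> \<Psi>c s w =
     (LINT x|lebesgue_on \<Omega>.
        \<gamma> / l * \<Psi>c (s x) + \<gamma> * l * ((norm (weak_grad \<Omega> s x))\<^sup>2 / 2) +
        1/2 * ((strain \<Omega> w x - (\<xi> * s x) *\<^sub>R mat 1) \<bullet>
               \<C> (strain \<Omega> w x - (\<xi> * s x) *\<^sub>R mat 1)))"

definition step_energy ::
  "(real^'d) set \<Rightarrow> (real^'d \<Rightarrow> real) set \<Rightarrow> real \<Rightarrow> real \<Rightarrow> real \<Rightarrow> real \<Rightarrow> real \<Rightarrow>
     (real^'d^'d \<Rightarrow> real^'d^'d) \<Rightarrow> (real \<Rightarrow> real) \<Rightarrow> (real \<Rightarrow> real) \<Rightarrow>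
     (real^'d \<Rightarrow> real) \<Rightarrow> (real^'d \<Rightarrow> real^'d) \<Rightarrow> (real^'d \<Rightarrow> real) \<Rightarrow>
     (real^'d \<Rightarrow> real) \<Rightarrow> (real^'d \<Rightarrow> real^'d) \<Rightarrow> real" where
  "step_energy \<Omega> Q \<gamma> l \<tau> m \<xi> \<C> \<Psi>c \<Psi>e R f \<phi>prev s w =
     (dual_norm_L2 \<Omega> m Q (\<lambda>x. s x - \<phi>prev x - \<tau> * R x))\<^sup>2 / (2 * \<tau>)
     + energy_c \<Omega> \<gamma> l \<xi> \<C> \<Psi>c s w
     - \<gamma> / l * l2_inner \<Omega> (\<lambda>x. deriv \<Psi>e (\<phi>prev x)) s
     - l2_inner \<Omega> f w"

definition Qbar ::
  "'a::euclidean_space set \<Rightarrow> ('a \<Rightarrow> real) set \<Rightarrow> real \<Rightarrow> ('a \<Rightarrow> real) \<Rightarrow> ('a \<Rightarrow> real) \<Rightarrow>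
     ('a \<Rightarrow> real) set" where
  "Qbar \<Omega> Q \<tau> R \<phi>prev =
     {s \<in> Q. (LINT x|lebesgue_on \<Omega>. (s x - \<phi>prev x) / \<tau>) = (LINT x|lebesgue_on \<Omega>. R x)}"

end

theory Submission
  imports Defs
begin

text \<open>
  Move from the current iterate towards the minimizer, the phase field by a fraction \<open>r\<close> and the
  displacement by a fraction \<open>t\<close>.  In these two parameters the energy is a convex function of
  \<open>r\<close> alone (coming from \<open>\<Psi>c\<close>) plus a quadratic polynomial, and the only term that couples
  the parameters is the elastic inner product of the strain increment \<open>e\<close> with the isotropic
  increment \<open>p = \<xi> \<delta> I\<close>, where \<open>\<delta>\<close> is the change of the phase field
  (\<open>step_energy_on_segments\<close>).  The curvature in \<open>r\<close> that does not come from elasticity is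
  \<open>\<parallel>\<delta>\<parallel>\<^sup>2/\<tau>\<close> in the dual norm plus \<open>\<gamma> l \<parallel>\<nabla>\<delta>\<parallel>\<^sup>2\<close>; by the inverse estimate and the Poincare
  inequality it is at least \<open>c\<close> times the elastic energy of \<open>p\<close>, with \<open>c\<close> the
  \<open>coercivity_ratio\<close> (\<open>chemical_coercivity\<close>), and \<open>\<beta>_ch = \<beta>_e = c / (1 + c)\<close>.

  The rest is a computation with two scalars.  Compare an exact block minimization with a move by
  the fraction \<open>b = c / (1 + c)\<close> of that block alone.  If the displacement is optimal
  for the phase field, moving \<open>r\<close> to \<open>b\<close> removes the fraction \<open>b\<close> of the energy gap: convexity
  would give this for a simultaneous move of both blocks, and the cost of leaving the displacement
  behind is paid by the strong convexity along the segment.  If instead the phase field is optimal,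
  the same holds for moving \<open>t\<close> to \<open>b\<close>.  These are \<open>contraction_first_variable\<close> and
  \<open>contraction_second_variable\<close>; each half step contracts the gap by \<open>1 - b\<close>.  Since \<open>\<Psi>c\<close> is
  convex, the Lipschitz constant of its derivative is nonnegative, hence \<open>L_ch \<ge> 1\<close> and
  \<open>1 - b \<le> 1 - \<beta>_ch / L_ch\<close>, which is the stated rate.

  Two points need analysis.  The weak gradient is a chosen representative, and its linearity almost
  everywhere rests on the uniqueness of weak gradients, that is, on the fundamental lemma of the
  calculus of variations; it is proved here from explicit smooth bumps that exhaust boxes.  And the
  dual norm is a supremum; that its square is a quadratic polynomial along lines follows from the
  Riesz representation of functionals on the finite-dimensional mean-zero space
  (\<open>dual_norm_L2_power2_quadratic\<close>).
\<close>

section \<open>Smooth bump functions\<close>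

text \<open>
  The family \<open>t\<^sup>-\<^sup>n exp (-1/t)\<close>, extended by zero to \<open>t \<le> 0\<close>, is closed under
  differentiation up to linear combinations.  All orders of smoothness therefore follow from one
  derivative formula that holds for every \<open>n\<close>.
\<close>

definition exp_bump :: "nat \<Rightarrow> real \<Rightarrow> real" where
  "exp_bump n t = (if t > 0 then inverse t ^ n * exp (- inverse t) else 0)"

lemma exp_bump_tendsto_0: "(exp_bump n \<longlongrightarrow> 0) (at 0)"
proof -
  have "((\<lambda>t. inverse t ^ n / exp (inverse t)) \<longlongrightarrow> (0::real)) (at_right 0)"
    using filterlim_compose[OF tendsto_power_div_exp_0[of n] filterlim_inverse_at_top_right] .
  moreover have "\<forall>\<^sub>F t in at_right 0. inverse t ^ n / exp (inverse t) = exp_bump n t"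
    using eventually_at_right_less[of "0::real"]
    by eventually_elim (simp add: exp_bump_def exp_minus divide_inverse)
  ultimately have "(exp_bump n \<longlongrightarrow> 0) (at_right 0)"
    by (rule Lim_transform_eventually)
  moreover have "(exp_bump n \<longlongrightarrow> 0) (at_left 0)"
  proof (rule Lim_transform_eventually[OF tendsto_const])
    show "\<forall>\<^sub>F t in at_left 0. 0 = exp_bump n t"
      by (auto simp: eventually_at_filter exp_bump_def)
  qed
  ultimately show ?thesis by (simp add: filterlim_split_at)
qed

text \<open>
  Only \<open>t = 0\<close> needs an argument: there the difference quotient is the next function of the
  family, which tends to 0 because the exponential beats every power of \<open>1/t\<close>.
\<close>

lemma exp_bump_has_derivative:
  "(exp_bump n has_real_derivative exp_bump (n + 2) t - real n * exp_bump (n + 1) t) (at t)"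
proof -
  consider "t > 0" | "t < 0" | "t = 0" by linarith
  then show ?thesis
  proof cases
    case 1
    have "((\<lambda>t. inverse t ^ n * exp (- inverse t)) has_real_derivative
            exp_bump (n + 2) t - real n * exp_bump (n + 1) t) (at t)"
      using 1
      by (auto intro!: derivative_eq_intros simp: exp_bump_def)
         (cases n; simp add: field_simps power2_eq_square)
    then show ?thesis
    proof (rule has_field_derivative_transform_within_open[of _ _ _ "{0<..}"])
    qed (use 1 in \<open>auto simp: exp_bump_def\<close>)
  next
    case 2
    have "((\<lambda>t. 0) has_real_derivative exp_bump (n + 2) t - real n * exp_bump (n + 1) t) (at t)"
      using 2 by (simp add: exp_bump_def)
    then show ?thesis
      by (rule has_field_derivative_transform_within_open[of _ _ _ "{..<0}"])
         (use 2 in \<open>auto simp: exp_bump_def\<close>)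
  next
    case 3
    have "(\<lambda>s. (exp_bump n s - exp_bump n 0) / (s - 0)) = exp_bump (Suc n)"
      by (auto simp: exp_bump_def divide_inverse)
    then show ?thesis
      using exp_bump_tendsto_0[of "Suc n"] 3
      by (simp add: has_field_derivative_iff) (simp add: exp_bump_def)
  qed
qed

lemma Ck_SucI:
  assumes "\<And>x. (f has_derivative f' x) (at x)" "\<And>v. Ck k (\<lambda>x. f' x v)"
  shows "Ck (Suc k) f"
proof -
  have "frechet_derivative f (at x) = f' x" for x
    using assms(1) by (rule frechet_derivative_at[symmetric])
  then show ?thesis using assms by (auto simp: differentiable_def)
qed

lemma Ck_has_derivative:
  "Ck (Suc k) f \<Longrightarrow> (f has_derivative frechet_derivative f (at x)) (at x)"
  using frechet_derivative_works by fastforce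

lemma Ck_Suc_imp_Ck: "Ck (Suc k) f \<Longrightarrow> Ck k f"
proof (induction k arbitrary: f)
  case 0
  then show ?case
    by (auto intro!: differentiable_imp_continuous_on simp: differentiable_on_def)
qed auto

lemma Ck_const: "Ck k (\<lambda>x. c)"
proof (induction k arbitrary: c)
  case (Suc k)
  show ?case by (rule Ck_SucI[where f' = "\<lambda>_ _. 0"]) (auto intro: Suc)
qed auto

lemma Ck_add: "Ck k f \<Longrightarrow> Ck k g \<Longrightarrow> Ck k (\<lambda>x. f x + g x)"
proof (induction k arbitrary: f g)
  case (Suc k)
  show ?case
    by (rule Ck_SucI[OF has_derivative_add[OF Ck_has_derivative[OF Suc.prems(1)]
            Ck_has_derivative[OF Suc.prems(2)]]], rule Suc.IH) (use Suc.prems in auto)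
qed (simp add: continuous_on_add)

text \<open>
  The derivative of a product contains the factors themselves, so the induction on the order also
  uses that the factors have one order of smoothness to spare.
\<close>

lemma Ck_mult: "Ck k f \<Longrightarrow> Ck k g \<Longrightarrow> Ck k (\<lambda>x. f x * g x)"
proof (induction k arbitrary: f g)
  case (Suc k)
  have "Ck k f" "Ck k g" using Suc.prems by (auto dest: Ck_Suc_imp_Ck simp del: Ck.simps)
  moreover have "Ck k (\<lambda>x. frechet_derivative f (at x) v)"
    "Ck k (\<lambda>x. frechet_derivative g (at x) v)" for v
    using Suc.prems by auto
  ultimately have "Ck k (\<lambda>x. f x * frechet_derivative g (at x) v + frechet_derivative f (at x) v * g x)" for v
    by (intro Ck_add Suc.IH)
  then show ?case
    by (rule Ck_SucI[OF has_derivative_mult[OF Ck_has_derivative[OF Suc.prems(1)]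
            Ck_has_derivative[OF Suc.prems(2)]]])
qed (simp add: continuous_on_mult)

lemma Ck_prod:
  assumes "finite A" "\<And>i. i \<in> A \<Longrightarrow> Ck k (f i)"
  shows "Ck k (\<lambda>x. \<Prod>i\<in>A. f i x)"
  using assms
proof (induction A rule: finite_induct)
  case empty
  show ?case by (simp only: prod.empty Ck_const)
next
  case (insert j A)
  then have "Ck k (\<lambda>x. f j x * (\<Prod>i\<in>A. f i x))" by (intro Ck_mult) auto
  then show ?case using insert.hyps by (simp del: Ck.simps)
qed

lemma Ck_exp_bump_affine: "Ck k (\<lambda>x. exp_bump n (x \<bullet> a + d))"
proof (induction k arbitrary: n)
  case 0
  have "continuous_on UNIV (exp_bump n)"
    using exp_bump_has_derivative DERIV_isCont continuous_at_imp_continuous_on by blast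
  then show ?case
    by (simp add: continuous_on_compose2[of UNIV "exp_bump n"] continuous_on_add continuous_on_inner)
next
  case (Suc k)
  let ?D = "\<lambda>x. exp_bump (n + 2) (x \<bullet> a + d) + (- real n) * exp_bump (n + 1) (x \<bullet> a + d)"
  show ?case
  proof (rule Ck_SucI[where f' = "\<lambda>x v. ?D x * (v \<bullet> a)"])
    fix x :: 'a
    have "((\<lambda>x. x \<bullet> a + d) has_derivative (\<lambda>v. v \<bullet> a)) (at x)"
      by (auto intro!: derivative_eq_intros)
    from has_derivative_compose[OF this, of "exp_bump n"]
    show "((\<lambda>x. exp_bump n (x \<bullet> a + d)) has_derivative (\<lambda>v. ?D x * (v \<bullet> a))) (at x)"
      using exp_bump_has_derivative[of n "x \<bullet> a + d"] by (simp add: has_field_derivative_def)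
  qed (intro Ck_mult Ck_add Ck_const Suc)
qed

text \<open>
  The factor at a face of the box vanishes up to distance \<open>1/k\<close> from that face, which keeps the
  support compact inside the open box, and tends to 1 at every interior point as \<open>k\<close> grows.
\<close>

definition box_bump :: "'a::euclidean_space \<Rightarrow> 'a \<Rightarrow> nat \<Rightarrow> 'a \<Rightarrow> real" where
  "box_bump a b k x =
     (\<Prod>i\<in>Basis. exp_bump 0 (real k * (x \<bullet> i - a \<bullet> i) - 1) * exp_bump 0 (real k * (b \<bullet> i - x \<bullet> i) - 1))"

lemma exp_bump_0_bounds: "0 \<le> exp_bump 0 t" "exp_bump 0 t \<le> 1"
  by (auto simp: exp_bump_def)

lemma box_bump_bounds: "0 \<le> box_bump a b k x" "box_bump a b k x \<le> 1"
  unfolding box_bump_def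
  by (auto intro!: prod_nonneg prod_le_1 mult_nonneg_nonneg mult_le_one simp: exp_bump_0_bounds)

lemma exp_bump_scaled_tendsto:
  "(\<lambda>k. exp_bump 0 (real k * d - 1)) \<longlonglongrightarrow> (if d > 0 then 1 else 0)"
proof (cases "d > 0")
  case True
  have "filterlim (\<lambda>k. real k * d) at_top sequentially"
    using True by (intro filterlim_at_top_mult_tendsto_pos[OF tendsto_const _ filterlim_real_sequentially])
  then have top: "filterlim (\<lambda>k. -1 + real k * d) at_top sequentially"
    by (rule filterlim_tendsto_add_at_top[OF tendsto_const])
  then have "(\<lambda>k. exp (- inverse (-1 + real k * d))) \<longlonglongrightarrow> exp (- 0)"
    by (intro tendsto_intros tendsto_inverse_0_at_top)
  moreover have "\<forall>\<^sub>F k in sequentially. exp (- inverse (-1 + real k * d)) = exp_bump 0 (real k * d - 1)"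
    using top[THEN filterlim_at_top_dense[THEN iffD1], rule_format, of 0]
    by eventually_elim (auto simp: exp_bump_def)
  ultimately have "(\<lambda>k. exp_bump 0 (real k * d - 1)) \<longlonglongrightarrow> exp (- 0)"
    by (rule Lim_transform_eventually)
  then show ?thesis using True by simp
next
  case False
  have "real k * d \<le> 0" for k
    using False by (simp add: mult_nonneg_nonpos)
  then have "\<not> real k * d - 1 > 0" for k by (smt (verit))
  then show ?thesis using False by (simp add: exp_bump_def)
qed

lemma box_bump_tendsto: "(\<lambda>k. box_bump a b k x) \<longlonglongrightarrow> indicat_real (box a b) x"
proof -
  let ?P = "(\<Prod>i\<in>Basis. (if x \<bullet> i - a \<bullet> i > 0 then 1 else 0) * (if b \<bullet> i - x \<bullet> i > 0 then 1 else 0)) :: real"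
  have "(\<lambda>k. box_bump a b k x) \<longlonglongrightarrow> ?P"
    unfolding box_bump_def by (intro tendsto_prod tendsto_mult exp_bump_scaled_tendsto)
  moreover have "?P = indicat_real (box a b) x"
  proof (cases "x \<in> box a b")
    case True
    then show ?thesis by (auto simp: mem_box intro!: prod.neutral)
  next
    case False
    then obtain i where i: "i \<in> Basis" "x \<bullet> i \<le> a \<bullet> i \<or> b \<bullet> i \<le> x \<bullet> i"
      by (auto simp: mem_box not_less)
    then have "?P = 0" by (subst prod_zero_iff[OF finite_Basis]) (auto intro!: bexI[of _ i])
    then show ?thesis using False by simp
  qed
  ultimately show ?thesis by simp
qed

lemma box_bump_test_function:
  assumes "box a b \<subseteq> \<Omega>" "k > 0"
  shows "box_bump a b k \<in> test_functions \<Omega>"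
proof -
  define e :: 'a where "e = (\<Sum>i\<in>Basis. (1 / real k) *\<^sub>R i)"
  have e: "e \<bullet> i = 1 / real k" if "i \<in> Basis" for i
    using that by (simp add: e_def inner_sum_left inner_Basis if_distrib sum.delta cong: if_cong)
  have "Ck n (box_bump a b k)" for n
  proof -
    have "box_bump a b k = (\<lambda>x. \<Prod>i\<in>Basis. exp_bump 0 (x \<bullet> (real k *\<^sub>R i) + (- real k * (a \<bullet> i) - 1))
        * exp_bump 0 (x \<bullet> (- real k *\<^sub>R i) + (real k * (b \<bullet> i) - 1)))"
      by (simp add: box_bump_def fun_eq_iff algebra_simps)
    then show ?thesis
      by (simp only:) (intro Ck_prod Ck_mult Ck_exp_bump_affine finite_Basis)
  qed
  moreover have supp: "closure {x. box_bump a b k x \<noteq> 0} \<subseteq> cbox (a + e) (b - e)"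
  proof (rule closure_minimal)
    show "{x. box_bump a b k x \<noteq> 0} \<subseteq> cbox (a + e) (b - e)"
    proof
      fix x assume "x \<in> {x. box_bump a b k x \<noteq> 0}"
      then have "\<forall>i\<in>Basis. real k * (x \<bullet> i - a \<bullet> i) > 1 \<and> real k * (b \<bullet> i - x \<bullet> i) > 1"
        by (auto simp: box_bump_def exp_bump_def split: if_splits)
      then show "x \<in> cbox (a + e) (b - e)"
        using assms(2) by (auto simp: mem_box inner_add_left inner_diff_left e field_simps less_imp_le)
    qed
  qed (rule closed_cbox)
  moreover have "cbox (a + e) (b - e) \<subseteq> box a b"
  proof
    fix x assume x: "x \<in> cbox (a + e) (b - e)"
    have pos: "0 < 1 / real k" using assms(2) by simp
    have "a \<bullet> i < x \<bullet> i \<and> x \<bullet> i < b \<bullet> i" if "i \<in> Basis" for i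
    proof -
      have "a \<bullet> i + 1 / real k \<le> x \<bullet> i \<and> x \<bullet> i \<le> b \<bullet> i - 1 / real k"
        using x that by (auto simp: mem_box inner_add_left inner_diff_left e)
      with pos show ?thesis by linarith
    qed
    then show "x \<in> box a b" by (auto simp: mem_box)
  qed
  ultimately show ?thesis
    using assms(1) compact_Int_closed[OF compact_cbox closed_closure, of "a + e" "b - e"
        "{x. box_bump a b k x \<noteq> 0}"]
    unfolding test_functions_def mem_Collect_eq by (metis Int_absorb1 order_trans)
qed

section \<open>The fundamental lemma of the calculus of variations\<close>

text \<open>
  Open boxes form an intersection-stable generator of the Borel sets, and for an integrable
  function the sets with zero integral are closed under complements (the whole space has zero
  integral) and countable disjoint unions.
\<close>

lemma set_integral_zero_on_boxes_imp_borel: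
  fixes F :: "'a::euclidean_space \<Rightarrow> real"
  assumes F: "integrable lebesgue F" and box: "\<And>c d. (LINT x:box c d|lebesgue. F x) = 0"
    and univ: "(LINT x|lebesgue. F x) = 0"
    and A: "A \<in> sets borel"
  shows "(LINT x:A|lebesgue. F x) = 0"
proof -
  have set_int: "set_integrable lebesgue A F" if "A \<in> sets borel" for A
    using integrable_mult_indicator[of A lebesgue F] that F by (simp add: set_integrable_def)
  have borel: "sets (borel :: 'a measure) = sigma_sets UNIV (range (\<lambda>(a, b). box a b))"
    by (subst borel_eq_box) simp
  have stable: "Int_stable (range (\<lambda>(a, b). box a b :: 'a set))"
  proof (rule Int_stableI)
    fix A B :: "'a set"
    assume "A \<in> range (\<lambda>(a, b). box a b)" "B \<in> range (\<lambda>(a, b). box a b)"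
    then obtain a b c d where "A = box a b" "B = box c d" by auto
    then show "A \<inter> B \<in> range (\<lambda>(a, b). box a b)"
      by (simp add: box_Int_box) (rule rev_image_eqI[OF UNIV_I], rule prod.case[symmetric])
  qed
  have "range (\<lambda>(a, b). box a b :: 'a set) \<subseteq> Pow UNIV" by simp
  with stable show ?thesis
    using A unfolding borel
  proof (induction rule: sigma_sets_induct_disjoint)
    case (basic A)
    then show ?case using box by auto
  next
    case empty
    show ?case by (simp add: set_lebesgue_integral_def)
  next
    case (compl A)
    have "A \<in> sets borel" using compl.hyps by (simp add: borel)
    then have "(LINT x:UNIV - A|lebesgue. F x) = (LINT x:UNIV|lebesgue. F x) - (LINT x:A|lebesgue. F x)"
      using set_integral_Un[of A "UNIV - A" lebesgue F] set_int by (auto simp: Un_absorb1)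
    then show ?case using compl univ by (simp add: set_lebesgue_integral_def)
  next
    case (union A)
    have meas: "A i \<in> sets borel" for i using union.hyps by (auto simp: borel)
    have "(LINT x:(\<Union>i. A i)|lebesgue. F x) = (\<Sum>i. LINT x:A i|lebesgue. F x)"
      using union.hyps(1) meas set_int[of "\<Union>i. A i"]
      by (intro lebesgue_integral_countable_add) (auto simp: disjoint_family_on_def)
    then show ?case using union.IH by simp
  qed
qed

lemma AE_zero_if_integral_zero_on_boxes:
  fixes F :: "'a::euclidean_space \<Rightarrow> real"
  assumes F: "integrable lebesgue F" and box: "\<And>c d. (LINT x:box c d|lebesgue. F x) = 0"
    and univ: "(LINT x|lebesgue. F x) = 0"
  shows "AE x in lebesgue. F x = 0"
proof -
  have "(LINT x:A|lebesgue. F x) = (LINT x:A|lebesgue. 0)" if A: "A \<in> sets lebesgue" for A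
  proof -
    obtain B N N' where B: "A = B \<union> N" "N \<subseteq> N'" "N' \<in> null_sets lborel" "B \<in> sets lborel"
      by (rule sets_completionE[OF A])
    have N: "AE x in lebesgue. x \<notin> N'"
      using B(3) null_sets_completionI[of N' lborel] AE_not_in by blast
    have B_sets: "B \<in> sets lebesgue" using B(4) by simp
    have "(LINT x:A|lebesgue. F x) = (LINT x:B|lebesgue. F x)"
      unfolding set_lebesgue_integral_def
    proof (rule integral_cong_AE)
      show "AE x in lebesgue. indicat_real A x *\<^sub>R F x = indicat_real B x *\<^sub>R F x"
        using N by eventually_elim (use B(1,2) in \<open>auto simp: indicator_def\<close>)
    qed (intro borel_measurable_scaleR borel_measurable_indicator A B_sets
          borel_measurable_integrable F)+
    also have "\<dots> = 0"
      using B(4) by (intro set_integral_zero_on_boxes_imp_borel[OF assms]) simp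
    finally show ?thesis by simp
  qed
  then show ?thesis by (intro density_unique_real F integrable_zero)
qed

text \<open>
  The bumps of a box inside the domain converge boundedly to its indicator, so the integral of
  \<open>f\<close> over every such box vanishes.  Restricted to one box, \<open>f\<close> then has zero integral over
  all boxes, since two boxes meet in a box, and hence is zero there; countably many boxes exhaust
  the domain.
\<close>

lemma fundamental_lemma_variations:
  fixes f :: "'a::euclidean_space \<Rightarrow> real"
  assumes \<Omega>: "open \<Omega>" and f: "integrable (lebesgue_on \<Omega>) f"
    and test: "\<And>\<psi>. \<psi> \<in> test_functions \<Omega> \<Longrightarrow> (LINT x|lebesgue_on \<Omega>. f x * \<psi> x) = 0"
  shows "AE x in lebesgue_on \<Omega>. f x = 0"
proof -
  have \<Omega>_sets: "\<Omega> \<in> sets lebesgue" using \<Omega> by (simp add: borel_open)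
  define F where "F x = indicat_real \<Omega> x * f x" for x
  have F: "integrable lebesgue F"
    using f \<Omega>_sets by (simp add: integrable_restrict_space F_def[abs_def])
  have box: "(LINT x:box c d|lebesgue. F x) = 0" if cd: "box c d \<subseteq> \<Omega>" for c d
  proof -
    have "(\<lambda>k. LINT x|lebesgue_on \<Omega>. f x * box_bump c d (Suc k) x) \<longlonglongrightarrow>
        (LINT x|lebesgue_on \<Omega>. f x * indicat_real (box c d) x)"
    proof (rule integral_dominated_convergence[where w = "\<lambda>x. norm (f x)"])
      have "box_bump c d k \<in> borel_measurable borel" for k :: nat
      proof (cases "k = 0")
        case False
        then have "Ck 0 (box_bump c d k)"
          using box_bump_test_function[of c d UNIV k] by (simp add: test_functions_def del: Ck.simps)
        then show ?thesis by (simp add: borel_measurable_continuous_onI)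
      next
        case True
        then show ?thesis unfolding box_bump_def by (simp add: exp_bump_def)
      qed
      then have [measurable]: "box_bump c d k \<in> borel_measurable (lebesgue_on \<Omega>)" for k :: nat
        by (intro measurable_restrict_space1 measurable_completion) simp
      show "(\<lambda>x. f x * box_bump c d (Suc k) x) \<in> borel_measurable (lebesgue_on \<Omega>)" for k
        using f by measurable
      show "(\<lambda>x. f x * indicat_real (box c d) x) \<in> borel_measurable (lebesgue_on \<Omega>)"
        using f by (intro borel_measurable_times borel_measurable_indicator)
          (use cd in \<open>auto simp: sets_restrict_space_iff \<Omega>_sets\<close>)
      show "AE x in lebesgue_on \<Omega>. (\<lambda>k. f x * box_bump c d (Suc k) x)
              \<longlonglongrightarrow> f x * indicat_real (box c d) x"
        by (intro AE_I2 tendsto_intros LIMSEQ_Suc[OF box_bump_tendsto])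
      show "AE x in lebesgue_on \<Omega>. norm (f x * box_bump c d (Suc k) x) \<le> norm (f x)" for k
        using box_bump_bounds[of c d "Suc k"]
        by (intro AE_I2) (simp add: abs_mult mult_left_le)
    qed (use f in auto)
    then have "(LINT x|lebesgue_on \<Omega>. f x * indicat_real (box c d) x) = 0"
      using test[OF box_bump_test_function[OF cd]] by (simp add: LIMSEQ_const_iff)
    then show ?thesis
      using \<Omega>_sets by (simp add: integral_restrict_space set_lebesgue_integral_def F_def algebra_simps)
  qed
  obtain D where D: "countable D" "D \<subseteq> Pow \<Omega>" "\<And>X. X \<in> D \<Longrightarrow> \<exists>a b. X = box a b" "\<Union>D = \<Omega>"
    by (rule open_countable_Union_open_box[OF \<Omega>]) (rule that)
  have "AE x in lebesgue. x \<in> X \<longrightarrow> F x = 0" if "X \<in> D" for X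
  proof -
    obtain a b where X: "X = box a b" "box a b \<subseteq> \<Omega>"
      using D(2) D(3)[OF \<open>X \<in> D\<close>] \<open>X \<in> D\<close> by auto
    \<comment> \<open>Localizing to one box reduces the claim to the whole-space criterion.\<close>
    have sub: "indicat_real (box c d) x * (indicat_real (box a b) x * F x) =
        indicat_real (box c d \<inter> box a b) x * F x" for c d x by (simp add: indicator_inter_arith)
    have "AE x in lebesgue. indicat_real (box a b) x * F x = 0"
    proof (rule AE_zero_if_integral_zero_on_boxes)
      show "integrable lebesgue (\<lambda>x. indicat_real (box a b) x * F x)"
        using integrable_mult_indicator[of "box a b" lebesgue F] F by simp
      show "(LINT x|lebesgue. indicat_real (box a b) x * F x) = 0"
        using box[OF X(2)] by (simp add: set_lebesgue_integral_def)
      show "(LINT x:box c d|lebesgue. indicat_real (box a b) x * F x) = 0" for c d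
      proof -
        obtain p q where "box c d \<inter> box a b = box p q" using box_Int_box by blast
        moreover have "box c d \<inter> box a b \<subseteq> \<Omega>" using X by auto
        ultimately show ?thesis
          using box[of p q] by (simp add: set_lebesgue_integral_def sub)
      qed
    qed
    then show ?thesis by eventually_elim (auto simp: X(1) indicator_def)
  qed
  then have "AE x in lebesgue. \<forall>X\<in>D. x \<in> X \<longrightarrow> F x = 0"
    using AE_ball_countable[OF D(1), of "\<lambda>x X. x \<in> X \<longrightarrow> F x = 0" lebesgue] by simp
  then have "AE x in lebesgue. x \<in> \<Omega> \<longrightarrow> f x = 0"
    by eventually_elim (use D(4) in \<open>auto simp: F_def indicator_def\<close>)
  then show ?thesis using \<Omega>_sets by (simp add: AE_restrict_space_iff)
qed

section \<open>Square-integrable functions\<close>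

lemma finite_measure_lebesgue_on_bounded:
  assumes "open \<Omega>" "bounded \<Omega>"
  shows "finite_measure (lebesgue_on (\<Omega> :: 'a::euclidean_space set))"
proof -
  have "\<Omega> \<in> lmeasurable" using assms bounded_set_imp_lmeasurable by (simp add: lmeasurable_open)
  then show ?thesis
    by (intro finite_measureI) (auto simp: emeasure_restrict_space fmeasurable_def space_restrict_space)
qed

lemma L2_I_AE_bounded:
  assumes "finite_measure (lebesgue_on \<Omega>)" "f \<in> borel_measurable (lebesgue_on \<Omega>)"
    and "AE x in lebesgue_on \<Omega>. norm (f x) \<le> B"
  shows "f \<in> L2 \<Omega>"
proof -
  have "integrable (lebesgue_on \<Omega>) (\<lambda>x. (norm (f x))\<^sup>2)"
  proof (rule finite_measure.integrable_const_bound[OF assms(1), where B = "B\<^sup>2"])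
    show "AE x in lebesgue_on \<Omega>. norm ((norm (f x))\<^sup>2) \<le> B\<^sup>2"
      using assms(3) by eventually_elim (simp add: power_mono)
  qed (use assms(2) in measurable)
  then show ?thesis using assms(2) by (simp add: L2_def)
qed

lemma L2_measurable: "f \<in> L2 \<Omega> \<Longrightarrow> f \<in> borel_measurable (lebesgue_on \<Omega>)"
  by (simp add: L2_def)

lemma L2_sq_integrable: "f \<in> L2 \<Omega> \<Longrightarrow> integrable (lebesgue_on \<Omega>) (\<lambda>x. (norm (f x))\<^sup>2)"
  by (simp add: L2_def)

lemma L2_inner_integrable:
  assumes "f \<in> L2 \<Omega>" "g \<in> L2 \<Omega>"
  shows "integrable (lebesgue_on \<Omega>) (\<lambda>x. f x \<bullet> g x)"
proof (rule Bochner_Integration.integrable_bound)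
  show "integrable (lebesgue_on \<Omega>) (\<lambda>x. (norm (f x))\<^sup>2 + (norm (g x))\<^sup>2)"
    using assms by (intro Bochner_Integration.integrable_add L2_sq_integrable)
  show "(\<lambda>x. f x \<bullet> g x) \<in> borel_measurable (lebesgue_on \<Omega>)"
    using assms by (intro borel_measurable_inner L2_measurable)
  show "AE x in lebesgue_on \<Omega>. norm (f x \<bullet> g x) \<le> norm ((norm (f x))\<^sup>2 + (norm (g x))\<^sup>2)"
  proof (rule AE_I2)
    fix x
    have "\<bar>f x \<bullet> g x\<bar> \<le> norm (f x) * norm (g x)" by (rule Cauchy_Schwarz_ineq2)
    also have "\<dots> \<le> (norm (f x))\<^sup>2 + (norm (g x))\<^sup>2"
      using sum_squares_bound[of "norm (f x)" "norm (g x)"]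
        mult_nonneg_nonneg[OF norm_ge_zero norm_ge_zero, of "f x" "g x"] by linarith
    finally show "norm (f x \<bullet> g x) \<le> norm ((norm (f x))\<^sup>2 + (norm (g x))\<^sup>2)" by simp
  qed
qed

lemma L2_scaleR: "f \<in> L2 \<Omega> \<Longrightarrow> (\<lambda>x. c *\<^sub>R f x) \<in> L2 \<Omega>"
  by (simp add: L2_def power_mult_distrib borel_measurable_scaleR)

lemma L2_add:
  assumes "f \<in> L2 \<Omega>" "g \<in> L2 \<Omega>"
  shows "(\<lambda>x. f x + g x) \<in> L2 \<Omega>"
proof -
  have "integrable (lebesgue_on \<Omega>) (\<lambda>x. (norm (f x))\<^sup>2 + (norm (g x))\<^sup>2 + 2 * (f x \<bullet> g x))"
    using assms
    by (intro Bochner_Integration.integrable_add integrable_mult_right L2_sq_integrable L2_inner_integrable)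
  moreover have "(norm (f x + g x))\<^sup>2 = (norm (f x))\<^sup>2 + (norm (g x))\<^sup>2 + 2 * (f x \<bullet> g x)" for x
    by (simp add: power2_norm_eq_inner inner_add_left inner_add_right inner_commute)
  ultimately show ?thesis
    using assms by (simp add: L2_def borel_measurable_add)
qed

lemma L2_lincomb: "f \<in> L2 \<Omega> \<Longrightarrow> g \<in> L2 \<Omega> \<Longrightarrow> (\<lambda>x. a *\<^sub>R f x + b *\<^sub>R g x) \<in> L2 \<Omega>"
  by (intro L2_add L2_scaleR)

lemma L2_bounded_linear:
  assumes "bounded_linear A" "f \<in> L2 \<Omega>"
  shows "(\<lambda>x. A (f x)) \<in> L2 \<Omega>"
proof -
  obtain K where K: "\<And>v. norm (A v) \<le> norm v * K" "K \<ge> 0"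
    using bounded_linear.nonneg_bounded[OF assms(1)] by blast
  have meas: "(\<lambda>x. A (f x)) \<in> borel_measurable (lebesgue_on \<Omega>)"
    using assms by (intro measurable_compose[OF L2_measurable borel_measurable_continuous_onI])
      (auto intro: linear_continuous_on)
  have "integrable (lebesgue_on \<Omega>) (\<lambda>x. (norm (A (f x)))\<^sup>2)"
  proof (rule Bochner_Integration.integrable_bound)
    show "integrable (lebesgue_on \<Omega>) (\<lambda>x. K\<^sup>2 * (norm (f x))\<^sup>2)"
      using assms(2) by (intro integrable_mult_right L2_sq_integrable)
    show "AE x in lebesgue_on \<Omega>. norm ((norm (A (f x)))\<^sup>2) \<le> norm (K\<^sup>2 * (norm (f x))\<^sup>2)"
      using K by (intro AE_I2) (simp flip: power_mult_distrib add: power_mono mult.commute)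
  qed (use meas in measurable)
  with meas show ?thesis by (simp add: L2_def)
qed

lemma l2_inner_commute: "l2_inner \<Omega> f g = l2_inner \<Omega> g f"
  by (simp add: l2_inner_def inner_commute)

lemma l2_inner_lincomb_left:
  assumes "f \<in> L2 \<Omega>" "g \<in> L2 \<Omega>" "k \<in> L2 \<Omega>"
  shows "l2_inner \<Omega> (\<lambda>x. a *\<^sub>R f x + b *\<^sub>R g x) k = a * l2_inner \<Omega> f k + b * l2_inner \<Omega> g k"
  using L2_inner_integrable[OF assms(1,3)] L2_inner_integrable[OF assms(2,3)]
  by (simp add: l2_inner_def inner_add_left)

lemma l2_inner_lincomb_right:
  assumes "f \<in> L2 \<Omega>" "g \<in> L2 \<Omega>" "k \<in> L2 \<Omega>"
  shows "l2_inner \<Omega> k (\<lambda>x. a *\<^sub>R f x + b *\<^sub>R g x) = a * l2_inner \<Omega> k f + b * l2_inner \<Omega> k g"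
  using l2_inner_lincomb_left[OF assms] by (simp add: l2_inner_commute)

lemma l2_inner_cong_AE:
  assumes "f \<in> L2 \<Omega>" "f' \<in> L2 \<Omega>" "g \<in> L2 \<Omega>" "g' \<in> L2 \<Omega>"
    and "AE x in lebesgue_on \<Omega>. f x = f' x" "AE x in lebesgue_on \<Omega>. g x = g' x"
  shows "l2_inner \<Omega> f g = l2_inner \<Omega> f' g'"
  unfolding l2_inner_def
proof (rule integral_cong_AE)
  show "AE x in lebesgue_on \<Omega>. f x \<bullet> g x = f' x \<bullet> g' x"
    using assms(5,6) by eventually_elim simp
qed (intro borel_measurable_inner L2_measurable assms)+

lemma l2_inner_AE_zero_right:
  "AE x in lebesgue_on \<Omega>. g x = 0 \<Longrightarrow> l2_inner \<Omega> f g = 0"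
  unfolding l2_inner_def by (rule integral_eq_zero_AE) (simp add: eventually_mono)

lemma l2_inner_self_nonneg: "0 \<le> l2_inner \<Omega> f f"
  unfolding l2_inner_def by (intro integral_nonneg_AE) simp

lemma l2_norm_power2: "(l2_norm \<Omega> f)\<^sup>2 = l2_inner \<Omega> f f"
  by (simp add: l2_norm_def l2_inner_self_nonneg)

lemma l2_norm_nonneg: "0 \<le> l2_norm \<Omega> f"
  by (simp add: l2_norm_def l2_inner_self_nonneg)

lemma l2_inner_self_eq_0_iff:
  assumes "f \<in> L2 \<Omega>"
  shows "l2_inner \<Omega> f f = 0 \<longleftrightarrow> (AE x in lebesgue_on \<Omega>. f x = 0)"
  unfolding l2_inner_def
  by (subst integral_nonneg_eq_0_iff_AE[OF L2_inner_integrable[OF assms assms]]) auto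

lemma L2_integrable:
  assumes "finite_measure (lebesgue_on \<Omega>)" "f \<in> L2 \<Omega>"
  shows "integrable (lebesgue_on \<Omega>) (f :: _ \<Rightarrow> real)"
proof -
  have "(\<lambda>x. 1::real) \<in> L2 \<Omega>"
    by (rule L2_I_AE_bounded[OF assms(1), where B = 1]) auto
  from L2_inner_integrable[OF assms(2) this] show ?thesis by simp
qed

section \<open>Linearity of the weak gradient\<close>

text \<open>
  A continuous function is bounded on the compact closure of the domain, whose measure is finite.
\<close>

lemma
  fixes \<Omega> :: "'a::euclidean_space set"
  assumes \<Omega>: "open \<Omega>" "bounded \<Omega>" and \<psi>: "\<psi> \<in> test_functions \<Omega>"
  shows test_function_L2: "\<psi> \<in> L2 \<Omega>"
    and test_function_deriv_L2: "(\<lambda>x. frechet_derivative \<psi> (at x) v) \<in> L2 \<Omega>"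
proof -
  have cont_L2: "g \<in> L2 \<Omega>" if g: "continuous_on UNIV g" for g :: "'a \<Rightarrow> real"
  proof -
    have "compact (g ` closure \<Omega>)"
      using \<Omega>(2) g by (intro compact_continuous_image) (auto intro: continuous_on_subset)
    then obtain B where B: "\<forall>y \<in> g ` closure \<Omega>. norm y \<le> B"
      by (meson compact_imp_bounded bounded_iff)
    show ?thesis
    proof (rule L2_I_AE_bounded[OF finite_measure_lebesgue_on_bounded[OF \<Omega>], where B = B])
      show "g \<in> borel_measurable (lebesgue_on \<Omega>)"
        using borel_measurable_continuous_onI[OF g]
        by (intro measurable_restrict_space1 measurable_completion) simp
      show "AE x in lebesgue_on \<Omega>. norm (g x) \<le> B"
        using B closure_subset[of \<Omega>] by (intro AE_I2) auto
    qed
  qed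
  have "Ck 1 \<psi>" using \<psi> by (simp add: test_functions_def del: Ck.simps)
  then have 1: "Ck 0 \<psi>" "Ck 0 (\<lambda>x. frechet_derivative \<psi> (at x) v)"
    using Ck_Suc_imp_Ck[of 0 \<psi>] by auto
  then show "\<psi> \<in> L2 \<Omega>" "(\<lambda>x. frechet_derivative \<psi> (at x) v) \<in> L2 \<Omega>"
    by (auto intro: cont_L2)
qed

lemma L2_component: "g \<in> L2 \<Omega> \<Longrightarrow> (\<lambda>x. g x \<bullet> b) \<in> L2 \<Omega>"
  by (rule L2_bounded_linear[OF bounded_linear_inner_left])

text \<open>
  This uniqueness is what makes the chosen representative of the weak gradient behave, up to null
  sets, like a linear operator.
\<close>

lemma has_weak_grad_unique:
  fixes \<Omega> :: "'a::euclidean_space set"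
  assumes \<Omega>: "open \<Omega>" "bounded \<Omega>"
    and g: "g \<in> L2 \<Omega>" "has_weak_grad \<Omega> u g" and g': "g' \<in> L2 \<Omega>" "has_weak_grad \<Omega> u g'"
  shows "AE x in lebesgue_on \<Omega>. g x = g' x"
proof -
  have comp: "AE x in lebesgue_on \<Omega>. g x \<bullet> b - g' x \<bullet> b = 0" if b: "b \<in> Basis" for b
  proof (rule fundamental_lemma_variations[OF \<Omega>(1)])
    show "integrable (lebesgue_on \<Omega>) (\<lambda>x. g x \<bullet> b - g' x \<bullet> b)"
      by (intro Bochner_Integration.integrable_diff L2_integrable finite_measure_lebesgue_on_bounded
          L2_component \<Omega> g g')
    fix \<psi> assume \<psi>: "\<psi> \<in> test_functions \<Omega>"
    have "l2_inner \<Omega> (\<lambda>x. g x \<bullet> b) \<psi> = l2_inner \<Omega> (\<lambda>x. g' x \<bullet> b) \<psi>"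
      using g(2) g'(2) \<psi> b by (force simp: has_weak_grad_def)
    moreover have "integrable (lebesgue_on \<Omega>) (\<lambda>x. (g x \<bullet> b) * \<psi> x)"
      "integrable (lebesgue_on \<Omega>) (\<lambda>x. (g' x \<bullet> b) * \<psi> x)"
      using L2_inner_integrable[OF L2_component[OF g(1)] test_function_L2[OF \<Omega> \<psi>]]
        L2_inner_integrable[OF L2_component[OF g'(1)] test_function_L2[OF \<Omega> \<psi>]] by simp_all
    ultimately show "(LINT x|lebesgue_on \<Omega>. (g x \<bullet> b - g' x \<bullet> b) * \<psi> x) = 0"
      by (simp add: l2_inner_def left_diff_distrib)
  qed
  have "AE x in lebesgue_on \<Omega>. \<forall>b\<in>Basis. g x \<bullet> b - g' x \<bullet> b = 0"
    using comp by (simp add: AE_finite_all)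
  then show ?thesis by eventually_elim (auto intro: euclidean_eqI)
qed

lemma has_weak_grad_lincomb:
  fixes \<Omega> :: "'a::euclidean_space set"
  assumes \<Omega>: "open \<Omega>" "bounded \<Omega>"
    and u: "u \<in> L2 \<Omega>" "g \<in> L2 \<Omega>" "has_weak_grad \<Omega> u g"
    and v: "v \<in> L2 \<Omega>" "k \<in> L2 \<Omega>" "has_weak_grad \<Omega> v k"
  shows "has_weak_grad \<Omega> (\<lambda>x. a * u x + b * v x) (\<lambda>x. a *\<^sub>R g x + b *\<^sub>R k x)"
  unfolding has_weak_grad_def
proof (intro ballI)
  fix \<psi> :: "'a \<Rightarrow> real" and i :: 'a
  assume \<psi>: "\<psi> \<in> test_functions \<Omega>" and i: "i \<in> Basis"
  note L2 = test_function_L2[OF \<Omega> \<psi>] test_function_deriv_L2[OF \<Omega> \<psi>, of i]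
  have "l2_inner \<Omega> (\<lambda>x. a * u x + b * v x) (\<lambda>x. frechet_derivative \<psi> (at x) i)
      = a * l2_inner \<Omega> u (\<lambda>x. frechet_derivative \<psi> (at x) i)
        + b * l2_inner \<Omega> v (\<lambda>x. frechet_derivative \<psi> (at x) i)"
    using l2_inner_lincomb_left[OF u(1) v(1) L2(2)] by simp
  also have "\<dots> = - (a * l2_inner \<Omega> (\<lambda>x. g x \<bullet> i) \<psi> + b * l2_inner \<Omega> (\<lambda>x. k x \<bullet> i) \<psi>)"
    using u(3) v(3) \<psi> i by (simp add: has_weak_grad_def)
  also have "\<dots> = - l2_inner \<Omega> (\<lambda>x. (a *\<^sub>R g x + b *\<^sub>R k x) \<bullet> i) \<psi>"
    using l2_inner_lincomb_left[OF L2_component[OF u(2)] L2_component[OF v(2)] L2(1)]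
    by (simp add: inner_add_left)
  finally show "l2_inner \<Omega> (\<lambda>x. a * u x + b * v x) (\<lambda>x. frechet_derivative \<psi> (at x) i)
      = - l2_inner \<Omega> (\<lambda>x. (a *\<^sub>R g x + b *\<^sub>R k x) \<bullet> i) \<psi>" .
qed

lemma H1_L2: "u \<in> H1 \<Omega> \<Longrightarrow> u \<in> L2 \<Omega>"
  by (simp add: H1_def)

lemma
  assumes "u \<in> H1 \<Omega>"
  shows weak_grad_L2: "weak_grad \<Omega> u \<in> L2 \<Omega>"
    and has_weak_grad_weak_grad: "has_weak_grad \<Omega> u (weak_grad \<Omega> u)"
proof -
  have "\<exists>g. g \<in> L2 \<Omega> \<and> has_weak_grad \<Omega> u g" using assms by (auto simp: H1_def)
  from someI_ex[OF this] show "weak_grad \<Omega> u \<in> L2 \<Omega>" "has_weak_grad \<Omega> u (weak_grad \<Omega> u)"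
    by (simp_all add: weak_grad_def)
qed

lemma H1_lincomb:
  assumes "open \<Omega>" "bounded \<Omega>" "u \<in> H1 \<Omega>" "v \<in> H1 \<Omega>"
  shows "(\<lambda>x. a * u x + b * v x) \<in> H1 \<Omega>"
proof -
  have "(\<lambda>x. a * u x + b * v x) \<in> L2 \<Omega>"
    using L2_lincomb[OF H1_L2 H1_L2, OF assms(3,4), of a b] by simp
  moreover have "(\<lambda>x. a *\<^sub>R weak_grad \<Omega> u x + b *\<^sub>R weak_grad \<Omega> v x) \<in> L2 \<Omega>"
    by (intro L2_lincomb weak_grad_L2 assms)
  moreover have "has_weak_grad \<Omega> (\<lambda>x. a * u x + b * v x)
      (\<lambda>x. a *\<^sub>R weak_grad \<Omega> u x + b *\<^sub>R weak_grad \<Omega> v x)"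
    using assms by (intro has_weak_grad_lincomb H1_L2 weak_grad_L2 has_weak_grad_weak_grad)
  ultimately show ?thesis unfolding H1_def by blast
qed

lemma weak_grad_lincomb:
  assumes "open \<Omega>" "bounded \<Omega>" "u \<in> H1 \<Omega>" "v \<in> H1 \<Omega>"
  shows "AE x in lebesgue_on \<Omega>.
    weak_grad \<Omega> (\<lambda>x. a * u x + b * v x) x = a *\<^sub>R weak_grad \<Omega> u x + b *\<^sub>R weak_grad \<Omega> v x"
  by (rule has_weak_grad_unique[OF assms(1,2) weak_grad_L2[OF H1_lincomb]
        has_weak_grad_weak_grad[OF H1_lincomb]])
     (intro has_weak_grad_weak_grad weak_grad_L2 has_weak_grad_lincomb L2_lincomb H1_L2 assms)+

section \<open>Riesz representation on finite-dimensional function spaces\<close>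

definition lincomb_closed :: "('a \<Rightarrow> 'b::real_vector) set \<Rightarrow> bool" where
  "lincomb_closed W \<longleftrightarrow> W \<noteq> {} \<and> (\<forall>f\<in>W. \<forall>g\<in>W. \<forall>c d. (\<lambda>x. c *\<^sub>R f x + d *\<^sub>R g x) \<in> W)"

text \<open>
  Semidefinite rather than definite, because functions are not identified when they agree almost
  everywhere: an integral form vanishes on every function that is zero up to a null set.
\<close>

definition psd_form :: "('a \<Rightarrow> 'b::real_vector) set \<Rightarrow> (('a \<Rightarrow> 'b) \<Rightarrow> ('a \<Rightarrow> 'b) \<Rightarrow> real) \<Rightarrow> bool" where
  "psd_form W a \<longleftrightarrow> (\<forall>f\<in>W. \<forall>g\<in>W. a f g = a g f) \<and>
     (\<forall>f\<in>W. \<forall>g\<in>W. \<forall>k\<in>W. \<forall>c d. a (\<lambda>x. c *\<^sub>R f x + d *\<^sub>R g x) k = c * a f k + d * a g k) \<and>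
     (\<forall>f\<in>W. 0 \<le> a f f)"

lemma lincomb_closedD:
  "lincomb_closed W \<Longrightarrow> f \<in> W \<Longrightarrow> g \<in> W \<Longrightarrow> (\<lambda>x. c *\<^sub>R f x + d *\<^sub>R g x) \<in> W"
  by (simp add: lincomb_closed_def)

lemma lincomb_closed_Int:
  assumes "lincomb_closed V" "lincomb_closed W"
  shows "lincomb_closed (V \<inter> W)"
proof -
  have zero: "(\<lambda>x. 0) \<in> U" if U: "lincomb_closed U" for U :: "('a \<Rightarrow> 'b) set"
  proof -
    obtain f where "f \<in> U" using U by (auto simp: lincomb_closed_def)
    from lincomb_closedD[OF U this this, of 0 0] show ?thesis by simp
  qed
  then have "(\<lambda>x. 0) \<in> V \<inter> W" using assms by simp
  then show ?thesis using assms unfolding lincomb_closed_def by blast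
qed

lemma fun_span_lincomb_closed: "lincomb_closed (fun_span B)"
proof -
  have "(\<lambda>x. c *\<^sub>R f x + d *\<^sub>R g x) \<in> fun_span B" if fg: "f \<in> fun_span B" "g \<in> fun_span B" for f g c d
  proof -
    obtain u v where "f = (\<lambda>x. \<Sum>b\<in>B. u b *\<^sub>R b x)" "g = (\<lambda>x. \<Sum>b\<in>B. v b *\<^sub>R b x)"
      using fg by (auto simp: fun_span_def)
    then have "(\<lambda>x. c *\<^sub>R f x + d *\<^sub>R g x) = (\<lambda>x. \<Sum>b\<in>B. (c * u b + d * v b) *\<^sub>R b x)"
      by (simp add: fun_eq_iff scaleR_sum_right sum.distrib scaleR_add_left)
    then show ?thesis unfolding fun_span_def by (auto intro!: exI[of _ "\<lambda>b. c * u b + d * v b"])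
  qed
  moreover have "(\<lambda>x. \<Sum>b\<in>B. 0 *\<^sub>R b x) \<in> fun_span B"
    unfolding fun_span_def by (rule CollectI, rule exI[of _ "\<lambda>_. 0"]) simp
  ultimately show ?thesis unfolding lincomb_closed_def by blast
qed

text \<open>
  Adding one generator raises the dimension by at most one, so any function outside the smaller
  span can replace the new generator.
\<close>

lemma fun_span_insert_decompose:
  assumes B: "finite B" "b \<notin> B" and w: "w \<in> fun_span (insert b B)" "w \<notin> fun_span B"
    and q: "q \<in> fun_span (insert b B)"
  obtains c where "(\<lambda>x. 1 *\<^sub>R q x + (- c) *\<^sub>R w x) \<in> fun_span B"
proof -
  obtain u where u: "w = (\<lambda>x. u b *\<^sub>R b x + (\<Sum>y\<in>B. u y *\<^sub>R y x))"
    using w(1) B by (auto simp: fun_span_def)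
  obtain v where v: "q = (\<lambda>x. v b *\<^sub>R b x + (\<Sum>y\<in>B. v y *\<^sub>R y x))"
    using q B by (auto simp: fun_span_def)
  have ub: "u b \<noteq> 0"
  proof
    assume "u b = 0"
    then have "w = (\<lambda>x. \<Sum>y\<in>B. u y *\<^sub>R y x)" using u by simp
    then show False using w(2) by (auto simp: fun_span_def)
  qed
  define c where "c = v b / u b"
  have "(\<lambda>x. 1 *\<^sub>R q x + (- c) *\<^sub>R w x) = (\<lambda>x. \<Sum>y\<in>B. (v y - c * u y) *\<^sub>R y x)"
    using ub by (simp add: u v c_def fun_eq_iff scaleR_sum_right scaleR_left_diff_distrib
        sum_subtractf scaleR_add_right sum_negf)
  then have "(\<lambda>x. 1 *\<^sub>R q x + (- c) *\<^sub>R w x) \<in> fun_span B"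
    unfolding fun_span_def by (auto intro!: exI[of _ "\<lambda>y. v y - c * u y"])
  then show ?thesis by (rule that)
qed

lemma psd_form_commute: "psd_form W a \<Longrightarrow> f \<in> W \<Longrightarrow> g \<in> W \<Longrightarrow> a f g = a g f"
  and psd_form_lincomb_left: "psd_form W a \<Longrightarrow> f \<in> W \<Longrightarrow> g \<in> W \<Longrightarrow> k \<in> W \<Longrightarrow>
    a (\<lambda>x. c *\<^sub>R f x + d *\<^sub>R g x) k = c * a f k + d * a g k"
  and psd_form_nonneg: "psd_form W a \<Longrightarrow> f \<in> W \<Longrightarrow> 0 \<le> a f f"
  by (simp_all add: psd_form_def)

lemma psd_form_lincomb_right:
  assumes "lincomb_closed W" "psd_form W a" "f \<in> W" "g \<in> W" "k \<in> W"
  shows "a k (\<lambda>x. c *\<^sub>R f x + d *\<^sub>R g x) = c * a k f + d * a k g"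
proof -
  have "a k (\<lambda>x. c *\<^sub>R f x + d *\<^sub>R g x) = a (\<lambda>x. c *\<^sub>R f x + d *\<^sub>R g x) k"
    by (rule psd_form_commute[OF assms(2,5) lincomb_closedD[OF assms(1,3,4)]])
  then show ?thesis
    using assms by (simp add: psd_form_lincomb_left psd_form_commute[of W a k])
qed

lemma psd_form_square:
  assumes "lincomb_closed W" "psd_form W a" "f \<in> W" "g \<in> W"
  shows "a (\<lambda>x. c *\<^sub>R f x + d *\<^sub>R g x) (\<lambda>x. c *\<^sub>R f x + d *\<^sub>R g x)
    = c\<^sup>2 * a f f + 2 * c * d * a f g + d\<^sup>2 * a g g"
  using assms
  by (simp add: psd_form_lincomb_left psd_form_lincomb_right lincomb_closedD
      psd_form_commute[of W a g f] algebra_simps power2_eq_square)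

text \<open>
  As the form may be degenerate, a null vector \<open>g\<close> needs its own case: then
  \<open>a (f + t g) (f + t g)\<close> is affine in \<open>t\<close> and nonnegative, hence constant.
\<close>

lemma psd_form_Cauchy_Schwarz:
  assumes "lincomb_closed W" "psd_form W a" "f \<in> W" "g \<in> W"
  shows "(a f g)\<^sup>2 \<le> a f f * a g g"
proof -
  have pos: "0 \<le> c\<^sup>2 * a f f + 2 * c * d * a f g + d\<^sup>2 * a g g" for c d
    using psd_form_nonneg[OF assms(2) lincomb_closedD[OF assms(1,3,4), of c d]]
    by (simp only: psd_form_square[OF assms])
  show ?thesis
  proof (cases "a g g = 0")
    case True
    have "a f g = 0"
    proof (rule ccontr)
      assume "a f g \<noteq> 0"
      then have "0 \<le> a f f + (- (2 * a f f) - 2) / 2"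
        using pos[of 1 "- (a f f + 1) / (2 * a f g)"] True by simp
      then show False using psd_form_nonneg[OF assms(2,3)] by (simp add: field_simps)
    qed
    then show ?thesis using True by simp
  next
    case False
    then have "0 < a g g" using psd_form_nonneg[OF assms(2,4)] by simp
    have "0 \<le> (a g g)\<^sup>2 * a f f + 2 * a g g * (- a f g) * a f g + (- a f g)\<^sup>2 * a g g"
      by (rule pos)
    also have "\<dots> = a g g * (a f f * a g g - (a f g)\<^sup>2)"
      by (simp add: power2_eq_square algebra_simps)
    finally show ?thesis using \<open>0 < a g g\<close> by (simp add: zero_le_mult_iff)
  qed
qed

text \<open>
  Gram-Schmidt as an induction on the generators.  The space is allowed to be any subspace of the
  span, because the mean-zero functions come without a basis of their own.  The functional has to
  vanish on the kernel of the form; by the Cauchy-Schwarz inequality this also holds for the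
  functional \<open>a w\<close>, to which the induction hypothesis is applied in order to find the orthogonal
  projection of the new direction \<open>w\<close>.
\<close>

lemma Riesz_representation_fun_span:
  fixes W :: "('a \<Rightarrow> 'b::real_vector) set"
  assumes "finite B" "lincomb_closed W" "W \<subseteq> fun_span B" "psd_form W a"
    and "\<And>f g c d. f \<in> W \<Longrightarrow> g \<in> W \<Longrightarrow> F (\<lambda>x. c *\<^sub>R f x + d *\<^sub>R g x) = c * F f + d * F g"
    and "\<And>f. f \<in> W \<Longrightarrow> a f f = 0 \<Longrightarrow> F f = 0"
  shows "\<exists>r\<in>W. \<forall>q\<in>W. a r q = F q"
  using assms
proof (induction B arbitrary: W F rule: finite_induct)
  case empty
  then have W: "W = {\<lambda>x. 0}" by (auto simp: fun_span_def lincomb_closed_def)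
  have "a (\<lambda>x. 0) (\<lambda>x. 0) = 0"
    using psd_form_lincomb_left[OF empty.prems(3), of "\<lambda>x. 0" "\<lambda>x. 0" "\<lambda>x. 0" 0 0] W by simp
  then show ?case using empty.prems(5)[of "\<lambda>x. 0"] W by simp
next
  case (insert b B)
  note lin = insert.prems(1) and psd = insert.prems(3) and F_lin = insert.prems(4)
  note lc = lincomb_closedD[OF lin]
  show ?case
  proof (cases "W \<subseteq> fun_span B")
    case True
    then show ?thesis using insert.IH insert.prems by blast
  next
    case False
    then obtain w where w: "w \<in> W" "w \<notin> fun_span B" by auto
    define W' where "W' = W \<inter> fun_span B"
    have W'_W: "f \<in> W" if "f \<in> W'" for f using that by (simp add: W'_def)
    have lin': "lincomb_closed W'"
      unfolding W'_def by (intro lincomb_closed_Int lin fun_span_lincomb_closed)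
    have psd': "psd_form W' a"
      using psd by (simp add: psd_form_def W'_def)
    have IH: "\<exists>r\<in>W'. \<forall>q\<in>W'. a r q = G q"
      if "\<And>f g c d. f \<in> W' \<Longrightarrow> g \<in> W' \<Longrightarrow> G (\<lambda>x. c *\<^sub>R f x + d *\<^sub>R g x) = c * G f + d * G g"
        "\<And>f. f \<in> W' \<Longrightarrow> a f f = 0 \<Longrightarrow> G f = 0" for G
      by (rule insert.IH[OF lin' _ psd']) (auto simp: W'_def intro: that[unfolded W'_def])
    obtain r0 where r0: "r0 \<in> W'" "\<And>q. q \<in> W' \<Longrightarrow> a r0 q = F q"
      using IH[of F] F_lin insert.prems(5) W'_W by blast
    have "\<exists>p\<in>W'. \<forall>q\<in>W'. a p q = a w q"
    proof (rule IH)
      fix f assume f: "f \<in> W'" "a f f = 0"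
      then have "(a w f)\<^sup>2 \<le> 0"
        using psd_form_Cauchy_Schwarz[OF lin psd w(1) W'_W[OF f(1)]] by simp
      then show "a w f = 0" by simp
    qed (simp add: psd_form_lincomb_right[OF lin psd] w(1) W'_W)
    then obtain p where p: "p \<in> W'" "\<And>q. q \<in> W' \<Longrightarrow> a p q = a w q" by blast
    \<comment> \<open>The component of the new direction orthogonal to the smaller space.\<close>
    define e where "e = (\<lambda>x. 1 *\<^sub>R w x + (-1) *\<^sub>R p x)"
    have e: "e \<in> W" unfolding e_def using w(1) W'_W[OF p(1)] by (rule lc)
    have e_orth: "a e q = 0" if "q \<in> W'" for q
      using psd_form_lincomb_left[OF psd w(1) W'_W[OF p(1)] W'_W[OF that], of 1 "-1"] p(2)[OF that]
      by (simp add: e_def)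
    have right_e: "a k e = a k w - a k p" if "k \<in> W" for k
      using psd_form_lincomb_right[OF lin psd w(1) W'_W[OF p(1)] that, of 1 "-1"]
      by (simp add: e_def)
    have F_e: "F e = F w - F p"
      using F_lin[OF w(1) W'_W[OF p(1)], of 1 "-1"] by (simp add: e_def)
    define k where "k = (if a e e = 0 then 0 else F e / a e e)"
    have k: "k * a e e = F e" using insert.prems(5)[OF e] by (auto simp: k_def)
    define r where "r = (\<lambda>x. 1 *\<^sub>R r0 x + k *\<^sub>R e x)"
    have r: "r \<in> W" unfolding r_def using W'_W[OF r0(1)] e by (rule lc)
    have a_r: "a r q = a r0 q + k * a e q" if "q \<in> W" for q
      using psd_form_lincomb_left[OF psd W'_W[OF r0(1)] e that, of 1 k] by (simp add: r_def)
    have r_W': "a r q = F q" if "q \<in> W'" for q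
      using that by (simp add: a_r W'_W r0(2) e_orth)
    have r_w: "a r w = F w"
    proof -
      have "a r0 e = 0" 
        using psd_form_commute[OF psd W'_W[OF r0(1)] e] e_orth[OF r0(1)] by simp
      then have "a r0 w = F p" using right_e[OF W'_W[OF r0(1)]] r0(2)[OF p(1)] by simp
      moreover have "a e w = a e e" using right_e[OF e] e_orth[OF p(1)] by simp
      ultimately show ?thesis using a_r[OF w(1)] k F_e by simp
    qed
    have "a r q = F q" if q: "q \<in> W" for q
    proof -
      obtain c where c: "(\<lambda>x. 1 *\<^sub>R q x + (- c) *\<^sub>R w x) \<in> fun_span B"
        using fun_span_insert_decompose[OF insert.hyps _ w(2), of q] w(1) q insert.prems(2) by blast
      define v where "v = (\<lambda>x. 1 *\<^sub>R q x + (- c) *\<^sub>R w x)"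
      have v: "v \<in> W'" unfolding W'_def v_def using c lc[OF q w(1), of 1 "- c"] by simp
      have "a r v = a r q - c * a r w"
        using psd_form_lincomb_right[OF lin psd q w(1) r, of 1 "- c"] by (simp add: v_def)
      moreover have "F v = F q - c * F w"
        using F_lin[OF q w(1), of 1 "- c"] by (simp add: v_def)
      ultimately show ?thesis using r_W'[OF v] r_w by simp
    qed
    then show ?thesis using r by blast
  qed
qed

section \<open>The dual norm as a Hilbert norm\<close>

locale mean_zero_space =
  fixes \<Omega> :: "'a::euclidean_space set" and Q B :: "('a \<Rightarrow> real) set" and m C_P :: real
  assumes \<Omega>: "open \<Omega>" "bounded \<Omega>" and m: "m > 0"
    and Q: "finite B" "Q = fun_span B" "Q \<subseteq> H1 \<Omega>"
    and poincare: "\<And>q. q \<in> mean_zero \<Omega> Q \<Longrightarrow> l2_norm \<Omega> q \<le> C_P * l2_norm \<Omega> (weak_grad \<Omega> q)"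
begin

definition grad_form :: "('a \<Rightarrow> real) \<Rightarrow> ('a \<Rightarrow> real) \<Rightarrow> real" where
  "grad_form q r = m * l2_inner \<Omega> (weak_grad \<Omega> q) (weak_grad \<Omega> r)"

lemma finite_measure: "finite_measure (lebesgue_on \<Omega>)"
  by (rule finite_measure_lebesgue_on_bounded[OF \<Omega>])

lemma Q_lincomb_closed: "lincomb_closed Q"
  by (simp add: Q(2) fun_span_lincomb_closed)

lemma Q_L2: "q \<in> Q \<Longrightarrow> q \<in> L2 \<Omega>"
  using Q(3) H1_L2 by blast

lemma mean_zero_Q: "q \<in> mean_zero \<Omega> Q \<Longrightarrow> q \<in> Q"
  by (simp add: mean_zero_def)

lemma mean_zero_H1: "q \<in> mean_zero \<Omega> Q \<Longrightarrow> q \<in> H1 \<Omega>"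
  using Q(3) mean_zero_Q by blast

lemma mean_zero_lincomb_closed: "lincomb_closed (mean_zero \<Omega> Q)"
proof -
  have "(\<lambda>x. c *\<^sub>R f x + d *\<^sub>R g x) \<in> mean_zero \<Omega> Q"
    if f: "f \<in> mean_zero \<Omega> Q" and g: "g \<in> mean_zero \<Omega> Q" for f g c d
  proof -
    have "integrable (lebesgue_on \<Omega>) f" "integrable (lebesgue_on \<Omega>) g"
      using f g by (simp_all add: L2_integrable finite_measure Q_L2 mean_zero_Q)
    then show ?thesis
      using lincomb_closedD[OF Q_lincomb_closed mean_zero_Q[OF f] mean_zero_Q[OF g], of c d] f g
      by (simp add: mean_zero_def)
  qed
  moreover have "(\<lambda>x. 0) \<in> mean_zero \<Omega> Q"
  proof -
    obtain q where "q \<in> Q" using Q_lincomb_closed by (auto simp: lincomb_closed_def)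
    from lincomb_closedD[OF Q_lincomb_closed this this, of 0 0] show ?thesis
      by (simp add: mean_zero_def)
  qed
  ultimately show ?thesis unfolding lincomb_closed_def by blast
qed

lemma grad_form_psd: "psd_form (mean_zero \<Omega> Q) grad_form"
  unfolding psd_form_def
proof (intro conjI ballI allI)
  fix f g k c d
  assume "f \<in> mean_zero \<Omega> Q" "g \<in> mean_zero \<Omega> Q" "k \<in> mean_zero \<Omega> Q"
  then have H1: "f \<in> H1 \<Omega>" "g \<in> H1 \<Omega>" "k \<in> H1 \<Omega>" by (simp_all add: mean_zero_H1)
  have "l2_inner \<Omega> (weak_grad \<Omega> (\<lambda>x. c *\<^sub>R f x + d *\<^sub>R g x)) (weak_grad \<Omega> k) =
      l2_inner \<Omega> (\<lambda>x. c *\<^sub>R weak_grad \<Omega> f x + d *\<^sub>R weak_grad \<Omega> g x) (weak_grad \<Omega> k)"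
    using weak_grad_lincomb[OF \<Omega> H1(1,2), of c d] H1_lincomb[OF \<Omega> H1(1,2), of c d] H1
    by (intro l2_inner_cong_AE) (auto intro: weak_grad_L2 L2_lincomb)
  also have "\<dots> = c * l2_inner \<Omega> (weak_grad \<Omega> f) (weak_grad \<Omega> k)
      + d * l2_inner \<Omega> (weak_grad \<Omega> g) (weak_grad \<Omega> k)"
    using H1 by (intro l2_inner_lincomb_left weak_grad_L2)
  finally show "grad_form (\<lambda>x. c *\<^sub>R f x + d *\<^sub>R g x) k = c * grad_form f k + d * grad_form g k"
    by (simp add: grad_form_def algebra_simps)
next
  fix f show "0 \<le> grad_form f f"
    using m by (simp add: grad_form_def l2_inner_self_nonneg)
qed (simp add: grad_form_def l2_inner_commute)

lemma hm_norm_eq: "hm_norm \<Omega> m q = sqrt (grad_form q q)"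
  using m by (simp add: hm_norm_def l2_norm_def l2_inner_def grad_form_def)

text \<open>
  The Poincare inequality makes the gradient form definite up to null sets, so every functional
  given by an \<open>L\<^sup>2\<close> function vanishes on its kernel and the Riesz representation applies.
\<close>

lemma grad_form_definite:
  assumes "q \<in> mean_zero \<Omega> Q" "grad_form q q = 0"
  shows "AE x in lebesgue_on \<Omega>. q x = 0"
proof -
  have "l2_norm \<Omega> (weak_grad \<Omega> q) = 0"
    using assms(2) m by (simp add: grad_form_def l2_norm_def)
  then have "l2_norm \<Omega> q \<le> 0" using poincare[OF assms(1)] by simp
  then have "l2_norm \<Omega> q = 0" using l2_norm_nonneg[of \<Omega> q] by simp
  then have "l2_inner \<Omega> q q = 0" by (simp add: l2_norm_def)
  then show ?thesis
    using l2_inner_self_eq_0_iff[OF Q_L2[OF mean_zero_Q[OF assms(1)]]] by blast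
qed

lemma L2_functional_represented:
  assumes "s \<in> L2 \<Omega>"
  shows "\<exists>r\<in>mean_zero \<Omega> Q. \<forall>q\<in>mean_zero \<Omega> Q. grad_form r q = l2_inner \<Omega> s q"
proof (rule Riesz_representation_fun_span[OF Q(1) mean_zero_lincomb_closed _ grad_form_psd])
  show "mean_zero \<Omega> Q \<subseteq> fun_span B" using Q(2) by (auto simp: mean_zero_def)
  show "l2_inner \<Omega> s (\<lambda>x. c *\<^sub>R f x + d *\<^sub>R g x) = c * l2_inner \<Omega> s f + d * l2_inner \<Omega> s g"
    if "f \<in> mean_zero \<Omega> Q" "g \<in> mean_zero \<Omega> Q" for f g c d
    by (rule l2_inner_lincomb_right) (use that assms Q_L2 mean_zero_Q in auto)
  show "l2_inner \<Omega> s f = 0" if "f \<in> mean_zero \<Omega> Q" "grad_form f f = 0" for f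
    by (rule l2_inner_AE_zero_right[OF grad_form_definite[OF that]])
qed

text \<open>
  The supremum is bounded by Cauchy-Schwarz and attained at the representer.  If the representer
  is zero almost everywhere it does not compete in the supremum, but then its norm is 0, which is
  in the set.
\<close>

lemma dual_norm_L2_eq_representer_norm:
  assumes r: "r \<in> mean_zero \<Omega> Q" "\<And>q. q \<in> mean_zero \<Omega> Q \<Longrightarrow> grad_form r q = l2_inner \<Omega> s q"
  shows "dual_norm_L2 \<Omega> m Q s = sqrt (grad_form r r)"
proof -
  note CS = psd_form_Cauchy_Schwarz[OF mean_zero_lincomb_closed grad_form_psd]
  let ?S = "insert 0 {l2_inner \<Omega> s q / hm_norm \<Omega> m q | q.
            q \<in> mean_zero \<Omega> Q \<and> \<not> (AE x in lebesgue_on \<Omega>. q x = 0)}"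
  have "Sup ?S = sqrt (grad_form r r)"
  proof (rule cSup_eq_maximum)
    show "sqrt (grad_form r r) \<in> ?S"
    proof (cases "AE x in lebesgue_on \<Omega>. r x = 0")
      case True
      then have "grad_form r r = 0"
        using r(2)[OF r(1)] by (simp add: l2_inner_AE_zero_right)
      then show ?thesis by simp
    next
      case False
      have "l2_inner \<Omega> s r / hm_norm \<Omega> m r = sqrt (grad_form r r)"
        using r(2)[OF r(1)] psd_form_nonneg[OF grad_form_psd r(1)]
        by (simp add: hm_norm_eq real_div_sqrt flip: r(2)[OF r(1)])
      then show ?thesis using False r(1) by force
    qed
  next
    fix y assume "y \<in> ?S"
    then consider "y = 0" | q where "q \<in> mean_zero \<Omega> Q" "\<not> (AE x in lebesgue_on \<Omega>. q x = 0)"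
        "y = l2_inner \<Omega> s q / hm_norm \<Omega> m q" by blast
    then show "y \<le> sqrt (grad_form r r)"
    proof cases
      case 1
      then show ?thesis using psd_form_nonneg[OF grad_form_psd r(1)] by simp
    next
      case 2
      have pos: "0 < grad_form q q"
        using 2 grad_form_definite psd_form_nonneg[OF grad_form_psd, of q] by fastforce
      have "l2_inner \<Omega> s q \<le> sqrt (grad_form r r * grad_form q q)"
        using CS[OF r(1) 2(1)] r(2)[OF 2(1)] by (intro real_le_rsqrt) simp
      then show ?thesis
        using pos by (simp add: 2 hm_norm_eq real_sqrt_mult divide_le_eq)
    qed
  qed
  then show ?thesis by (simp add: dual_norm_L2_def dual_norm_def)
qed

text \<open>
  A supremum of linear functionals is only known to be convex; because it is the norm of a
  representer that depends linearly on the functional, its square is exactly quadratic along lines.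
\<close>

lemma dual_norm_L2_power2_quadratic:
  assumes "s \<in> L2 \<Omega>" "d \<in> L2 \<Omega>"
  shows "\<exists>b. \<forall>t. (dual_norm_L2 \<Omega> m Q (\<lambda>x. s x + t * d x))\<^sup>2
    = (dual_norm_L2 \<Omega> m Q s)\<^sup>2 + 2 * b * t + t\<^sup>2 * (dual_norm_L2 \<Omega> m Q d)\<^sup>2"
proof -
  obtain r where r: "r \<in> mean_zero \<Omega> Q" "\<And>q. q \<in> mean_zero \<Omega> Q \<Longrightarrow> grad_form r q = l2_inner \<Omega> s q"
    using L2_functional_represented[OF assms(1)] by blast
  obtain k where k: "k \<in> mean_zero \<Omega> Q" "\<And>q. q \<in> mean_zero \<Omega> Q \<Longrightarrow> grad_form k q = l2_inner \<Omega> d q"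
    using L2_functional_represented[OF assms(2)] by blast
  note psd = grad_form_psd and lc = mean_zero_lincomb_closed
  have power2: "(dual_norm_L2 \<Omega> m Q s')\<^sup>2 = grad_form r' r'"
    if "r' \<in> mean_zero \<Omega> Q" "\<And>q. q \<in> mean_zero \<Omega> Q \<Longrightarrow> grad_form r' q = l2_inner \<Omega> s' q" for r' s'
    using dual_norm_L2_eq_representer_norm[OF that] psd_form_nonneg[OF psd that(1)] by simp
  have "(dual_norm_L2 \<Omega> m Q (\<lambda>x. s x + t * d x))\<^sup>2
      = grad_form r r + 2 * grad_form r k * t + t\<^sup>2 * grad_form k k" for t
  proof -
    have "(dual_norm_L2 \<Omega> m Q (\<lambda>x. s x + t * d x))\<^sup>2
        = grad_form (\<lambda>x. 1 *\<^sub>R r x + t *\<^sub>R k x) (\<lambda>x. 1 *\<^sub>R r x + t *\<^sub>R k x)"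
    proof (rule power2[OF lincomb_closedD[OF lc r(1) k(1)]])
      fix q assume q: "q \<in> mean_zero \<Omega> Q"
      have "l2_inner \<Omega> (\<lambda>x. s x + t * d x) q = l2_inner \<Omega> s q + t * l2_inner \<Omega> d q"
        using l2_inner_lincomb_left[OF assms Q_L2[OF mean_zero_Q[OF q]], of 1 t] by simp
      then show "grad_form (\<lambda>x. 1 *\<^sub>R r x + t *\<^sub>R k x) q = l2_inner \<Omega> (\<lambda>x. s x + t * d x) q"
        using psd_form_lincomb_left[OF psd r(1) k(1) q, of 1 t] r(2)[OF q] k(2)[OF q] by simp
    qed
    then show ?thesis by (simp only: psd_form_square[OF lc psd r(1) k(1)]) simp
  qed
  then show ?thesis using power2[OF r] power2[OF k] by auto
qed

end

section \<open>Finite element functions are essentially bounded\<close>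

text \<open>
  On each of the finitely many compact cells the function agrees almost everywhere with a
  polynomial.  Nonlinear functions of finite element functions are integrable for this reason.
\<close>

lemma piecewise_polynomial_AE_bounded:
  fixes s :: "'a::euclidean_space \<Rightarrow> 'b::euclidean_space"
  assumes mesh: "mesh_of \<Omega> T" and \<Omega>: "open \<Omega>" "bounded \<Omega>" and s: "piecewise_polynomial T s"
  shows "\<exists>B. AE x in lebesgue_on \<Omega>. norm (s x) \<le> B"
proof -
  have T: "finite T" "\<Union>T = closure \<Omega>" "\<And>K. K \<in> T \<Longrightarrow> K = closure (interior K)"
    using mesh unfolding mesh_of_def by blast+
  have cell: "\<exists>B. AE x in lebesgue. x \<in> K \<longrightarrow> norm (s x) \<le> B" if K: "K \<in> T" for K
  proof -
    have "closed K" using T(3)[OF K] closed_closure by metis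
    moreover have "bounded K"
      by (rule bounded_subset[of "closure \<Omega>"]) (use K T(2) \<Omega>(2) in auto)
    ultimately have "compact K" by (simp add: compact_eq_bounded_closed)
    obtain p where p: "polynomial_function p" "AE x in lebesgue_on K. s x = p x"
      using s K by (auto simp: piecewise_polynomial_def)
    have "compact (p ` K)"
      using p(1) \<open>compact K\<close> by (intro compact_continuous_image continuous_on_polymonial_function)
    then obtain B where B: "\<forall>y \<in> p ` K. norm y \<le> B" by (meson compact_imp_bounded bounded_iff)
    have "K \<in> sets lebesgue" using \<open>closed K\<close> by (simp add: borel_closed)
    then have "AE x in lebesgue. x \<in> K \<longrightarrow> s x = p x"
      using p(2) by (simp add: AE_restrict_space_iff)
    then have "AE x in lebesgue. x \<in> K \<longrightarrow> norm (s x) \<le> B"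
      by eventually_elim (use B in auto)
    then show ?thesis by blast
  qed
  have "\<exists>B. \<forall>K\<in>T. AE x in lebesgue. x \<in> K \<longrightarrow> norm (s x) \<le> B K"
    using cell by (intro bchoice) blast
  then obtain B where B: "\<forall>K\<in>T. AE x in lebesgue. x \<in> K \<longrightarrow> norm (s x) \<le> B K" by blast
  then have "AE x in lebesgue. \<forall>K\<in>T. x \<in> K \<longrightarrow> norm (s x) \<le> B K"
    using T(1) by (simp add: AE_finite_all)
  then have "AE x in lebesgue. x \<in> \<Omega> \<longrightarrow> norm (s x) \<le> (\<Sum>K\<in>T. \<bar>B K\<bar>)"
  proof eventually_elim
    case (elim x)
    show ?case
    proof
      assume "x \<in> \<Omega>"
      then obtain K where K: "K \<in> T" "x \<in> K" using T(2) closure_subset by blast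
      then have "norm (s x) \<le> \<bar>B K\<bar>" using elim by fastforce
      also have "\<dots> \<le> (\<Sum>K\<in>T. \<bar>B K\<bar>)" using K(1) T(1) by (intro member_le_sum) auto
      finally show "norm (s x) \<le> (\<Sum>K\<in>T. \<bar>B K\<bar>)" .
    qed
  qed
  moreover have "\<Omega> \<in> sets lebesgue" using \<Omega>(1) by (simp add: borel_open)
  ultimately show ?thesis by (auto simp: AE_restrict_space_iff)
qed

lemma L2_compose_essentially_bounded:
  fixes s :: "'a::euclidean_space \<Rightarrow> real" and F :: "real \<Rightarrow> real"
  assumes fin: "finite_measure (lebesgue_on \<Omega>)" and s: "s \<in> L2 \<Omega>"
    and bdd: "AE x in lebesgue_on \<Omega>. norm (s x) \<le> B"
    and F: "F \<in> borel_measurable borel" "\<And>y. \<bar>y\<bar> \<le> B \<Longrightarrow> \<bar>F y\<bar> \<le> B'"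
  shows "(\<lambda>x. F (s x)) \<in> L2 \<Omega>"
proof (rule L2_I_AE_bounded[OF fin, where B = B'])
  show "(\<lambda>x. F (s x)) \<in> borel_measurable (lebesgue_on \<Omega>)"
    by (rule measurable_compose[OF L2_measurable[OF s] F(1)])
  show "AE x in lebesgue_on \<Omega>. norm (F (s x)) \<le> B'"
    using bdd by eventually_elim (simp add: F(2))
qed

lemma convex_differentiable_imp_mono_deriv:
  fixes F :: "real \<Rightarrow> real"
  assumes "convex_on UNIV F" "\<And>a. F differentiable (at a)"
  shows "mono (deriv F)"
proof (rule monoI)
  fix a b :: real assume "a \<le> b"
  have D: "(F has_real_derivative deriv F x) (at x)" for x
    using assms(2)[of x] by (simp add: DERIV_deriv_iff_real_differentiable)
  show "deriv F a \<le> deriv F b"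
  proof (cases "a = b")
    case False
    have "deriv F a * (b - a) \<le> F b - F a" "deriv F b * (a - b) \<le> F a - F b"
      using convex_on_imp_above_tangent[OF assms(1), of a b] convex_on_imp_above_tangent[OF assms(1), of b a] D
      by auto
    then have "deriv F a * (b - a) \<le> deriv F b * (b - a)" by (simp add: algebra_simps)
    then show ?thesis using False \<open>a \<le> b\<close> by simp
  qed simp
qed

section \<open>The strain operator\<close>

text \<open>
  The strain is a sum of fixed linear images of the component gradients, so it inherits square
  integrability and almost-everywhere linearity from the weak gradient.
\<close>

definition strain_part :: "'d \<Rightarrow> real^'d \<Rightarrow> real^'d^'d" where
  "strain_part i v = (1/2) *\<^sub>R ((\<chi> k l. if k = i then v $ l else 0) + transpose (\<chi> k l. if k = i then v $ l else 0))"

lemma bounded_linear_strain_part: "bounded_linear (strain_part i)"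
  unfolding linear_conv_bounded_linear[symmetric]
  by (rule linearI) (simp_all add: strain_part_def transpose_def vec_eq_iff algebra_simps add_divide_distrib)

lemma strain_eq_sum: "strain \<Omega> w x = (\<Sum>i\<in>UNIV. strain_part i (weak_grad \<Omega> (\<lambda>y. w y $ i) x))"
  by (simp add: strain_def strain_part_def Let_def vec_eq_iff transpose_def sum_component
      sum.distrib flip: sum_divide_distrib)

lemma transpose_strain: "transpose (strain \<Omega> w x) = strain \<Omega> w x"
  by (simp add: strain_def Let_def transpose_def vec_eq_iff add.commute)

lemma L2_sum: "finite I \<Longrightarrow> (\<And>i. i \<in> I \<Longrightarrow> f i \<in> L2 \<Omega>) \<Longrightarrow> (\<lambda>x. \<Sum>i\<in>I. f i x) \<in> L2 \<Omega>"
proof (induction I rule: finite_induct)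
  case (insert i I)
  then have "(\<lambda>x. f i x + (\<Sum>i\<in>I. f i x)) \<in> L2 \<Omega>" by (intro L2_add) auto
  then show ?case using insert.hyps by simp
qed (simp add: L2_def)

lemma H10_vec_component: "w \<in> H10_vec \<Omega> \<Longrightarrow> (\<lambda>x. w x $ i) \<in> H1 \<Omega>"
  by (simp add: H10_vec_def H10_def)

lemma strain_sym_L2:
  assumes "w \<in> H10_vec \<Omega>"
  shows "strain \<Omega> w \<in> sym_L2 \<Omega>"
proof -
  have "(\<lambda>x. \<Sum>i\<in>UNIV. strain_part i (weak_grad \<Omega> (\<lambda>y. w y $ i) x)) \<in> L2 \<Omega>"
    by (intro L2_sum finite L2_bounded_linear[OF bounded_linear_strain_part] weak_grad_L2
        H10_vec_component[OF assms])
  then have "strain \<Omega> w \<in> L2 \<Omega>" by (simp add: strain_eq_sum[abs_def])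
  then show ?thesis by (simp add: sym_L2_def transpose_strain)
qed

lemma strain_lincomb:
  assumes "open \<Omega>" "bounded \<Omega>" "w \<in> H10_vec \<Omega>" "w' \<in> H10_vec \<Omega>"
  shows "AE x in lebesgue_on \<Omega>. strain \<Omega> (\<lambda>x. a *\<^sub>R w x + b *\<^sub>R w' x) x
    = a *\<^sub>R strain \<Omega> w x + b *\<^sub>R strain \<Omega> w' x"
proof -
  have "AE x in lebesgue_on \<Omega>. \<forall>i\<in>UNIV. weak_grad \<Omega> (\<lambda>y. a * w y $ i + b * w' y $ i) x
      = a *\<^sub>R weak_grad \<Omega> (\<lambda>y. w y $ i) x + b *\<^sub>R weak_grad \<Omega> (\<lambda>y. w' y $ i) x"
    by (rule AE_finite_allI[OF finite])
       (rule weak_grad_lincomb[OF assms(1,2) H10_vec_component H10_vec_component, OF assms(3,4)])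
  then show ?thesis
  proof eventually_elim
    case (elim x)
    interpret bounded_linear "strain_part i" for i by (rule bounded_linear_strain_part)
    show ?case
      using elim by (simp add: strain_eq_sum add scale scaleR_sum_right sum.distrib)
  qed
qed

section \<open>Alternating minimization of a function of two scalars\<close>

text \<open>
  The energy on the segment from one pair to another, with the two components moved independently
  by \<open>r\<close> and \<open>t\<close>.  The numbers \<open>K\<close>, \<open>E\<close> and \<open>P\<close> are the Gram matrix of the elastic
  form, \<open>X\<close> is the strong convexity in \<open>r\<close> that does not come from elasticity, and \<open>c\<close>
  compares the two.
\<close>

locale scalar_energy =
  fixes h :: "real \<Rightarrow> real \<Rightarrow> real" and g :: "real \<Rightarrow> real" and c2 X E P K c :: real
  assumes h_eq: "\<And>r t. h r t = g r + c2 * t + (X * r\<^sup>2 + E * t\<^sup>2 - 2 * r * t * P + K * r\<^sup>2) / 2"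
    and g_convex: "\<And>r. 0 \<le> r \<Longrightarrow> r \<le> 1 \<Longrightarrow> g r \<le> (1 - r) * g 0 + r * g 1"
    and coupling: "\<And>r t. 0 \<le> K * r\<^sup>2 - 2 * r * t * P + E * t\<^sup>2"
    and c: "c > 0" and X: "c * K \<le> X"
begin

text \<open>
  The step length \<open>b\<close> solves \<open>(1 - b) c = b\<close>.  With it, the elastic curvature \<open>b K\<close> that is
  paid for moving \<open>r\<close> alone is covered by the part \<open>(1 - b) X\<close> of the remaining curvature.
\<close>

lemma contraction_first_variable:
  assumes opt: "\<And>t. h 0 0 \<le> h 0 t" and b: "b = c / (1 + c)"
  shows "h b 0 - h 1 1 \<le> (1 - b) * (h 0 0 - h 1 1)"
proof -
  have nonneg: "0 \<le> c2 * t + E / 2 * t\<^sup>2" for t using opt[of t] by (simp add: h_eq)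
  have E: "0 \<le> E" using coupling[of 0 1] by simp
  \<comment> \<open>Optimality in the second variable removes the linear term in \<open>t\<close>.\<close>
  have "c2 = 0"
  proof (rule ccontr)
    assume "c2 \<noteq> 0"
    define q where "q = c2 / (E + 1)"
    have q: "c2 = q * (E + 1)" "q \<noteq> 0" using E \<open>c2 \<noteq> 0\<close> by (simp_all add: q_def)
    have "0 \<le> c2 * (- q) + E / 2 * (- q)\<^sup>2" by (rule nonneg)
    also have "\<dots> = - (q\<^sup>2 * (E / 2 + 1))"
      by (simp add: q(1) field_simps power2_eq_square)
    also have "\<dots> < 0" using E q(2) by (simp add: zero_less_mult_iff)
    finally show False by simp
  qed
  have b01: "0 \<le> b" "b \<le> 1" using c by (simp_all add: b)
  have bc: "(1 - b) * c = b" using c by (simp add: b field_simps)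
  have "b * K = (1 - b) * (c * K)" by (simp only: mult.assoc[symmetric] bc)
  also have "\<dots> \<le> (1 - b) * X" using X b01 by (intro mult_left_mono) auto
  finally have XK: "(X + K) * b \<le> X + E - 2 * P + K"
    using coupling[of 1 1] by (simp add: algebra_simps)
  have "h b 0 - h 1 1 - (1 - b) * (h 0 0 - h 1 1)
      = (g b - ((1 - b) * g 0 + b * g 1)) + b / 2 * ((X + K) * b - (X + E - 2 * P + K))"
    by (simp add: h_eq \<open>c2 = 0\<close> algebra_simps power2_eq_square add_divide_distrib diff_divide_distrib)
  also have "\<dots> \<le> 0"
    using g_convex[OF b01] XK b01 by (intro add_nonpos_nonpos mult_nonneg_nonpos) auto
  finally show ?thesis by simp
qed

text \<open>
  Optimality in \<open>r\<close> together with convexity gives \<open>g 0 \<le> g 1\<close>, by comparing with small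
  \<open>r\<close>, for which the quadratic terms are negligible.  What remains is the quadratic inequality
  \<open>b E \<le> X + E - 2 P + K\<close>.  With increments \<open>e\<close> and \<open>p\<close> whose Gram matrix is \<open>E, P, K\<close>, its
  right side is at least \<open>c |p|\<^sup>2 + |e - p|\<^sup>2\<close>, and the minimum of this over \<open>p\<close> is \<open>b |e|\<^sup>2\<close>.
\<close>

lemma contraction_second_variable:
  assumes opt: "\<And>r. 0 \<le> r \<Longrightarrow> r \<le> 1 \<Longrightarrow> h 0 0 \<le> h r 0" and b: "b = c / (1 + c)"
  shows "h 0 b - h 1 1 \<le> (1 - b) * (h 0 0 - h 1 1)"
proof -
  have g01: "g 0 \<le> g 1"
  proof (rule ccontr)
    assume "\<not> g 0 \<le> g 1"
    define D where "D = g 0 - g 1"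
    have D: "D > 0" using \<open>\<not> g 0 \<le> g 1\<close> by (simp add: D_def)
    define S where "S = X + K"
    have S: "r * D \<le> S / 2 * r\<^sup>2" if "0 \<le> r" "r \<le> 1" for r
      using opt[OF that] g_convex[OF that] by (simp add: h_eq D_def S_def field_simps)
    \<comment> \<open>Small enough that the quadratic term cannot compensate the decrease \<open>D\<close> of \<open>g\<close>.\<close>
    define r where "r = min 1 (D / (\<bar>S\<bar> + 1))"
    have r: "0 < r" "r \<le> 1" "r \<le> D / (\<bar>S\<bar> + 1)"
      using D by (simp_all add: r_def add_pos_nonneg divide_pos_pos)
    have rD: "r * (\<bar>S\<bar> + 1) \<le> D"
      using r(3) by (simp add: pos_le_divide_eq add_nonneg_pos)
    have "r * D \<le> r * (S / 2 * r)" using S[of r] r by (simp add: power2_eq_square algebra_simps)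
    then have "D \<le> S / 2 * r" using r(1) by simp
    also have "\<dots> \<le> \<bar>S\<bar> / 2 * r" using r(1) by (intro mult_right_mono) auto
    also have "\<dots> < r * (\<bar>S\<bar> + 1)" using r(1) by (simp add: algebra_simps) (smt (verit) mult_nonneg_nonneg)
    finally show False using rD by simp
  qed
  have b01: "0 \<le> b" using c by (simp add: b)
  \<comment> \<open>The elastic form at \<open>(1 + c) p - e\<close> is \<open>1 + c\<close> times the quantity that must be nonnegative.\<close>
  have "0 \<le> K * (1 + c)\<^sup>2 - 2 * (1 + c) * 1 * P + E * 1\<^sup>2" by (rule coupling)
  also have "\<dots> = (1 + c) * ((1 + c) * K - 2 * P + (1 - b) * E)"
    using c by (simp add: b field_simps power2_eq_square)
  finally have "0 \<le> (1 + c) * K - 2 * P + (1 - b) * E" using c by (simp add: zero_le_mult_iff)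
  then have XE: "E * b \<le> X + E - 2 * P + K" using X by (simp add: algebra_simps)
  have "h 0 b - h 1 1 - (1 - b) * (h 0 0 - h 1 1)
      = b * (g 0 - g 1) + b / 2 * (E * b - (X + E - 2 * P + K))"
    by (simp add: h_eq algebra_simps power2_eq_square add_divide_distrib diff_divide_distrib)
  also have "\<dots> \<le> 0"
    using g01 XE b01 by (intro add_nonpos_nonpos mult_nonneg_nonpos) auto
  finally show ?thesis by simp
qed

end

section \<open>The incremental energy along segments\<close>

lemma L2_lincomb_closed: "lincomb_closed (L2 \<Omega>)"
proof -
  have "(\<lambda>x. 0) \<in> L2 \<Omega>" by (simp add: L2_def)
  then show ?thesis unfolding lincomb_closed_def by (auto intro: L2_lincomb)
qed

lemma l2_inner_psd: "psd_form (L2 \<Omega>) (l2_inner \<Omega>)"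
  unfolding psd_form_def
  by (intro conjI ballI allI l2_inner_commute l2_inner_self_nonneg l2_inner_lincomb_left)

lemma sym_L2_L2: "e \<in> sym_L2 \<Omega> \<Longrightarrow> e \<in> L2 \<Omega>"
  by (simp add: sym_L2_def)

lemma sym_L2_lincomb_closed: "lincomb_closed (sym_L2 \<Omega>)"
proof -
  have "(\<lambda>x. 0) \<in> sym_L2 \<Omega>" by (simp add: sym_L2_def L2_def transpose_def vec_eq_iff)
  moreover have "(\<lambda>x. c *\<^sub>R f x + d *\<^sub>R g x) \<in> sym_L2 \<Omega>"
    if f: "f \<in> sym_L2 \<Omega>" and g: "g \<in> sym_L2 \<Omega>" for f g c d
    using L2_lincomb[OF sym_L2_L2[OF f] sym_L2_L2[OF g], of c d] f g
    by (simp add: sym_L2_def transpose_def vec_eq_iff)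
  ultimately show ?thesis unfolding lincomb_closed_def by blast
qed

lemma elasticity_tensor_psd:
  assumes "elasticity_tensor \<Omega> \<C>"
  shows "psd_form (sym_L2 \<Omega>) (\<lambda>e w. l2_inner \<Omega> (\<lambda>x. \<C> (e x)) w)"
  using assms unfolding elasticity_tensor_def L2_inner_product_on_def psd_form_def by blast

lemma isotropic_sym_L2:
  assumes "s \<in> L2 \<Omega>"
  shows "(\<lambda>x. (\<xi> * s x) *\<^sub>R (mat 1 :: real^'d^'d)) \<in> sym_L2 (\<Omega> :: (real^'d) set)"
proof -
  have "(\<lambda>x. (\<xi> * s x) *\<^sub>R (mat 1 :: real^'d^'d)) \<in> L2 \<Omega>"
    by (rule L2_bounded_linear[OF _ assms]) 
      (intro bounded_linear_intros)
  then show ?thesis by (simp add: sym_L2_def transpose_def vec_eq_iff mat_def) 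
qed

lemma H10_vec_L2:
  fixes \<Omega> :: "(real^'d) set"
  assumes "w \<in> H10_vec \<Omega>"
  shows "w \<in> L2 \<Omega>"
proof -
  have "(\<lambda>x. \<Sum>i\<in>UNIV. (w x $ i) *\<^sub>R (axis i 1 :: real^'d)) \<in> L2 \<Omega>"
    by (intro L2_sum finite L2_bounded_linear[OF bounded_linear_scaleR_left] H1_L2
        H10_vec_component[OF assms])
  moreover have "(\<lambda>x. \<Sum>i\<in>UNIV. (w x $ i) *\<^sub>R (axis i 1 :: real^'d)) = w"
    by (simp add: fun_eq_iff vec_eq_iff sum_component axis_def if_distrib cong: if_cong)
  ultimately show ?thesis by simp
qed

text \<open>
  Coercivity of the tensor is only given in integrated form; testing it with the constant identity
  field turns it into a statement about matrices because the domain has positive measure.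
\<close>

lemma elasticity_identity_pos:
  fixes \<Omega> :: "(real^'d) set"
  assumes \<Omega>: "open \<Omega>" "bounded \<Omega>" "\<Omega> \<noteq> {}" and "elasticity_tensor \<Omega> \<C>"
  shows "0 < mat 1 \<bullet> \<C> (mat 1)"
proof -
  define \<mu> where "\<mu> = measure (lebesgue_on \<Omega>) \<Omega>"
  have \<Omega>_meas: "\<Omega> \<in> lmeasurable" using \<Omega> bounded_set_imp_lmeasurable by (simp add: lmeasurable_open)
  have "measure lebesgue \<Omega> \<noteq> 0"
    using \<Omega>(1,3) \<Omega>_meas open_not_negligible negligible_iff_measure0 by blast
  then have \<mu>: "\<mu> > 0"
    using \<Omega>_meas by (simp add: \<mu>_def measure_restrict_space fmeasurable_def measure_nonneg less_le)
  have const: "l2_inner \<Omega> (\<lambda>x. A) (\<lambda>x. B) = \<mu> * (A \<bullet> B)" for A B :: "real^'d^'d"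
    by (simp add: l2_inner_def \<mu>_def space_restrict_space)
  have "(\<lambda>x. (1 * 1) *\<^sub>R (mat 1 :: real^'d^'d)) \<in> sym_L2 \<Omega>"
    by (rule isotropic_sym_L2, rule L2_I_AE_bounded[OF finite_measure_lebesgue_on_bounded[OF \<Omega>(1,2)],
          where B = 1]) auto
  then have I: "(\<lambda>x. mat 1 :: real^'d^'d) \<in> sym_L2 \<Omega>" by simp
  obtain c where "c > 0" and coercive: "\<And>e. e \<in> sym_L2 \<Omega> \<Longrightarrow>
      c * (l2_norm \<Omega> e)\<^sup>2 \<le> l2_inner \<Omega> (\<lambda>x. \<C> (e x)) e"
    using assms(4) unfolding elasticity_tensor_def by blast
  have "(mat 1 :: real^'d^'d) \<noteq> 0" by (simp add: mat_def vec_eq_iff exI[of _ undefined])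
  then have "0 < c * (\<mu> * (mat 1 \<bullet> (mat 1 :: real^'d^'d)))" using \<open>c > 0\<close> \<mu> by simp
  also have "\<dots> \<le> \<mu> * (mat 1 \<bullet> \<C> (mat 1))"
    using coercive[OF I] by (simp add: l2_norm_power2 const inner_commute)
  finally show ?thesis using \<mu> by (simp add: zero_less_mult_iff)
qed

locale cahn_larche_step = mean_zero_space \<Omega> Q B m C_P
  for \<Omega> :: "(real^'d) set" and Q B m C_P +
  fixes T :: "(real^'d) set set" and V :: "(real^'d \<Rightarrow> real^'d) set"
    and \<gamma> l \<tau> \<xi> C_inv h :: real and \<C> :: "real^'d^'d \<Rightarrow> real^'d^'d" and \<Psi>c \<Psi>e :: "real \<Rightarrow> real"
    and R \<phi>prev :: "real^'d \<Rightarrow> real" and f :: "real^'d \<Rightarrow> real^'d"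
  assumes nonempty: "\<Omega> \<noteq> {}" and mesh: "mesh_of \<Omega> T"
    and Q_polynomial: "\<And>s. s \<in> Q \<Longrightarrow> piecewise_polynomial T s"
    and V: "lincomb_closed V" "V \<subseteq> H10_vec \<Omega>"
    and params: "\<gamma> > 0" "l > 0" "\<tau> > 0" "\<xi> \<noteq> 0" "C_inv > 0" "h > 0" "C_P > 0"
    and data: "R \<in> L2 \<Omega>" "f \<in> L2 \<Omega>" "\<phi>prev \<in> Q"
    and \<Psi>c: "convex_on UNIV \<Psi>c" "\<And>a. \<Psi>c differentiable (at a)"
    and \<Psi>e: "convex_on UNIV \<Psi>e" "\<And>a. \<Psi>e differentiable (at a)"
    and elasticity: "elasticity_tensor \<Omega> \<C>"
    and inverse_estimate:
      "\<And>s. s \<in> mean_zero \<Omega> Q \<Longrightarrow> l2_norm \<Omega> s \<le> C_inv * inverse h * dual_norm_L2 \<Omega> m Q s"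
begin

abbreviation "H \<equiv> step_energy \<Omega> Q \<gamma> l \<tau> m \<xi> \<C> \<Psi>c \<Psi>e R f \<phi>prev"

abbreviation "Qb \<equiv> Qbar \<Omega> Q \<tau> R \<phi>prev"

definition elastic_form where
  "elastic_form e w = l2_inner \<Omega> (\<lambda>x. \<C> (e x)) w"

definition elastic_strain where
  "elastic_strain s w x = strain \<Omega> w x - (\<xi> * s x) *\<^sub>R mat 1"

definition identity_modulus where
  "identity_modulus = mat 1 \<bullet> \<C> (mat 1)"

text \<open>
  Written so that the end points are recovered by simplification and membership in the spaces is
  closure under linear combinations.
\<close>

definition segment :: "(real^'d \<Rightarrow> 'b::real_vector) \<Rightarrow> (real^'d \<Rightarrow> 'b) \<Rightarrow> real \<Rightarrow> real^'d \<Rightarrow> 'b" where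
  "segment s s' r = (\<lambda>x. (1 - r) *\<^sub>R s x + r *\<^sub>R s' x)"

lemma segment_0 [simp]: "segment s s' 0 = s" and segment_1 [simp]: "segment s s' 1 = s'"
  by (simp_all add: segment_def)

lemma segment_Q: "s \<in> Q \<Longrightarrow> s' \<in> Q \<Longrightarrow> segment s s' r \<in> Q"
  unfolding segment_def by (rule lincomb_closedD[OF Q_lincomb_closed])

lemma segment_V: "w \<in> V \<Longrightarrow> w' \<in> V \<Longrightarrow> segment w w' t \<in> V"
  unfolding segment_def by (rule lincomb_closedD[OF V(1)])

lemma Q_H1: "s \<in> Q \<Longrightarrow> s \<in> H1 \<Omega>"
  using Q(3) by blast

lemma Qbar_Q: "s \<in> Qb \<Longrightarrow> s \<in> Q"
  by (simp add: Qbar_def)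

lemma Q_integrable: "s \<in> Q \<Longrightarrow> integrable (lebesgue_on \<Omega>) s"
  by (intro L2_integrable finite_measure Q_L2)

lemma Qbar_iff: "s \<in> Qb \<longleftrightarrow>
  s \<in> Q \<and> (LINT x|lebesgue_on \<Omega>. s x) = (LINT x|lebesgue_on \<Omega>. \<phi>prev x) + \<tau> * (LINT x|lebesgue_on \<Omega>. R x)"
proof (cases "s \<in> Q")
  case True
  then have "(LINT x|lebesgue_on \<Omega>. (s x - \<phi>prev x) / \<tau>)
      = ((LINT x|lebesgue_on \<Omega>. s x) - (LINT x|lebesgue_on \<Omega>. \<phi>prev x)) / \<tau>"
    using data(3) by (simp add: Q_integrable)
  then show ?thesis using True params(3) by (auto simp: Qbar_def field_simps)
qed (simp add: Qbar_def)

lemma segment_Qbar: "s \<in> Qb \<Longrightarrow> s' \<in> Qb \<Longrightarrow> segment s s' r \<in> Qb"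
  using segment_Q[of s s' r] by (simp add: Qbar_iff Q_integrable segment_def algebra_simps)

lemma Qbar_diff_mean_zero:
  assumes "s \<in> Qb" "s' \<in> Qb"
  shows "(\<lambda>x. s' x - s x) \<in> mean_zero \<Omega> Q"
  using assms lincomb_closedD[OF Q_lincomb_closed, of s' s 1 "-1"]
  by (simp add: Qbar_iff mean_zero_def Q_integrable)

text \<open>
  The potential is continuous and its argument is essentially bounded, so the composition is
  essentially bounded on a set of finite measure.
\<close>

lemma \<Psi>c_L2:
  assumes "s \<in> Q"
  shows "(\<lambda>x. \<Psi>c (s x)) \<in> L2 \<Omega>"
proof -
  obtain b where b: "AE x in lebesgue_on \<Omega>. norm (s x) \<le> b"
    using piecewise_polynomial_AE_bounded[OF mesh \<Omega> Q_polynomial[OF assms]] by blast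
  have cont: "continuous_on S \<Psi>c" for S
    using \<Psi>c(2) by (intro continuous_at_imp_continuous_on ballI differentiable_imp_continuous_within)
  have "compact (\<Psi>c ` {-b..b})" by (intro compact_continuous_image cont) simp
  then obtain b' where b': "\<forall>y \<in> \<Psi>c ` {-b..b}. norm y \<le> b'"
    by (meson compact_imp_bounded bounded_iff)
  have "\<bar>\<Psi>c y\<bar> \<le> b'" if "\<bar>y\<bar> \<le> b" for y
  proof -
    have "y \<in> {-b..b}" using that by (auto simp: abs_le_iff)
    then show ?thesis using b' by auto
  qed
  then show ?thesis
    by (rule L2_compose_essentially_bounded[OF finite_measure Q_L2[OF assms] b
          borel_measurable_continuous_onI[OF cont]])
qed

lemma deriv_\<Psi>e_L2: "(\<lambda>x. deriv \<Psi>e (\<phi>prev x)) \<in> L2 \<Omega>"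
proof -
  obtain b where b: "AE x in lebesgue_on \<Omega>. norm (\<phi>prev x) \<le> b"
    using piecewise_polynomial_AE_bounded[OF mesh \<Omega> Q_polynomial[OF data(3)]] by blast
  have mono: "mono (deriv \<Psi>e)" using \<Psi>e by (rule convex_differentiable_imp_mono_deriv)
  show ?thesis
  proof (rule L2_compose_essentially_bounded[OF finite_measure Q_L2[OF data(3)] b])
    show "deriv \<Psi>e \<in> borel_measurable borel" using mono by (rule borel_measurable_mono)
    fix y assume "\<bar>y\<bar> \<le> b"
    then have "deriv \<Psi>e (- b) \<le> deriv \<Psi>e y" "deriv \<Psi>e y \<le> deriv \<Psi>e b"
      by (auto intro!: monoD[OF mono])
    then show "\<bar>deriv \<Psi>e y\<bar> \<le> \<bar>deriv \<Psi>e (- b)\<bar> + \<bar>deriv \<Psi>e b\<bar>" by linarith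
  qed
qed

lemma elastic_psd: "psd_form (sym_L2 \<Omega>) elastic_form"
  using elasticity_tensor_psd[OF elasticity] by (simp add: elastic_form_def[abs_def])

lemma tensor_L2: "e \<in> L2 \<Omega> \<Longrightarrow> (\<lambda>x. \<C> (e x)) \<in> L2 \<Omega>"
  using elasticity L2_bounded_linear[of \<C>]
  by (simp add: elasticity_tensor_def linear_conv_bounded_linear)

lemma elastic_form_cong_AE:
  assumes "e \<in> L2 \<Omega>" "e' \<in> L2 \<Omega>" "AE x in lebesgue_on \<Omega>. e x = e' x"
  shows "elastic_form e e = elastic_form e' e'"
  unfolding elastic_form_def
proof (rule l2_inner_cong_AE)
  show "AE x in lebesgue_on \<Omega>. \<C> (e x) = \<C> (e' x)" using assms(3) by eventually_elim simp
qed (intro tensor_L2 assms)+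

lemma elastic_strain_sym_L2:
  assumes "s \<in> Q" "w \<in> V"
  shows "elastic_strain s w \<in> sym_L2 \<Omega>"
proof -
  have "strain \<Omega> w \<in> sym_L2 \<Omega>" using assms(2) V(2) strain_sym_L2 by blast
  from lincomb_closedD[OF sym_L2_lincomb_closed this isotropic_sym_L2[OF Q_L2[OF assms(1)]], of 1 "-1" \<xi>]
  show ?thesis by (simp add: elastic_strain_def[abs_def])
qed

lemma energy_c_eq:
  assumes "s \<in> Q" "w \<in> V"
  shows "energy_c \<Omega> \<gamma> l \<xi> \<C> \<Psi>c s w = \<gamma> / l * (LINT x|lebesgue_on \<Omega>. \<Psi>c (s x))
    + \<gamma> * l / 2 * l2_inner \<Omega> (weak_grad \<Omega> s) (weak_grad \<Omega> s)
    + 1 / 2 * elastic_form (elastic_strain s w) (elastic_strain s w)"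
proof -
  let ?M = "lebesgue_on \<Omega>"
  have e: "elastic_strain s w \<in> L2 \<Omega>" using assms by (intro sym_L2_L2 elastic_strain_sym_L2)
  have int: "integrable ?M (\<lambda>x. \<Psi>c (s x))"
    "integrable ?M (\<lambda>x. weak_grad \<Omega> s x \<bullet> weak_grad \<Omega> s x)"
    "integrable ?M (\<lambda>x. \<C> (elastic_strain s w x) \<bullet> elastic_strain s w x)"
    using assms e
    by (intro L2_integrable finite_measure \<Psi>c_L2 L2_inner_integrable weak_grad_L2 Q_H1 tensor_L2; simp)+
  have "energy_c \<Omega> \<gamma> l \<xi> \<C> \<Psi>c s w = (LINT x|?M. \<gamma> / l * \<Psi>c (s x)
      + \<gamma> * l / 2 * (weak_grad \<Omega> s x \<bullet> weak_grad \<Omega> s x)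
      + 1 / 2 * (\<C> (elastic_strain s w x) \<bullet> elastic_strain s w x))"
    unfolding energy_c_def
    by (simp add: elastic_strain_def power2_norm_eq_inner inner_commute)
  also have "\<dots> = \<gamma> / l * (LINT x|?M. \<Psi>c (s x))
    + \<gamma> * l / 2 * (LINT x|?M. weak_grad \<Omega> s x \<bullet> weak_grad \<Omega> s x)
    + 1 / 2 * (LINT x|?M. \<C> (elastic_strain s w x) \<bullet> elastic_strain s w x)"
    using int by simp
  finally show ?thesis by (simp add: l2_inner_def elastic_form_def)
qed

lemma potential_convex_on_segment:
  assumes "s \<in> Q" "s' \<in> Q" "0 \<le> r" "r \<le> 1"
  shows "(LINT x|lebesgue_on \<Omega>. \<Psi>c (segment s s' r x))
    \<le> (1 - r) * (LINT x|lebesgue_on \<Omega>. \<Psi>c (s x)) + r * (LINT x|lebesgue_on \<Omega>. \<Psi>c (s' x))"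
proof -
  have int: "integrable (lebesgue_on \<Omega>) (\<lambda>x. \<Psi>c (q x))" if "q \<in> Q" for q
    using that by (intro L2_integrable finite_measure \<Psi>c_L2)
  have "(LINT x|lebesgue_on \<Omega>. \<Psi>c (segment s s' r x))
      \<le> (LINT x|lebesgue_on \<Omega>. (1 - r) * \<Psi>c (s x) + r * \<Psi>c (s' x))"
  proof (rule integral_mono)
    show "\<Psi>c (segment s s' r x) \<le> (1 - r) * \<Psi>c (s x) + r * \<Psi>c (s' x)" for x
      using convex_onD[OF \<Psi>c(1) assms(3,4), of "s x" "s' x"] by (simp add: segment_def)
  qed (use assms int segment_Q in auto)
  also have "\<dots> = (1 - r) * (LINT x|lebesgue_on \<Omega>. \<Psi>c (s x)) + r * (LINT x|lebesgue_on \<Omega>. \<Psi>c (s' x))"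
    using assms int by simp
  finally show ?thesis .
qed

text \<open>
  Strong convexity of the chemical part relative to the elastic energy of the isotropic strain
  \<open>\<xi> s I\<close>, both measured by the \<open>L\<^sup>2\<close> norm of \<open>s\<close>.
\<close>

definition coercivity_ratio where
  "coercivity_ratio = (h\<^sup>2 / (\<tau> * C_inv\<^sup>2) + \<gamma> * l / C_P\<^sup>2) / (\<xi>\<^sup>2 * identity_modulus)"

lemma identity_modulus_pos: "0 < identity_modulus"
  unfolding identity_modulus_def by (rule elasticity_identity_pos[OF \<Omega> nonempty elasticity])

lemma coercivity_ratio_pos: "0 < coercivity_ratio"
  unfolding coercivity_ratio_def using params identity_modulus_pos
  by (intro divide_pos_pos add_pos_pos mult_pos_pos) auto

text \<open>
  The inverse estimate bounds the \<open>L\<^sup>2\<close> norm by the dual norm and the Poincare inequality bounds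
  it by the gradient norm; each contributes one summand of the ratio.
\<close>

lemma chemical_coercivity:
  assumes \<delta>: "\<delta> \<in> mean_zero \<Omega> Q"
  shows "coercivity_ratio * (\<xi>\<^sup>2 * identity_modulus * (l2_norm \<Omega> \<delta>)\<^sup>2)
    \<le> (dual_norm_L2 \<Omega> m Q \<delta>)\<^sup>2 / \<tau> + \<gamma> * l * (l2_norm \<Omega> (weak_grad \<Omega> \<delta>))\<^sup>2"
proof -
  let ?N = "(l2_norm \<Omega> \<delta>)\<^sup>2"
  have "?N \<le> (C_inv * inverse h * dual_norm_L2 \<Omega> m Q \<delta>)\<^sup>2"
    by (rule power_mono[OF inverse_estimate[OF \<delta>] l2_norm_nonneg])
  then have "h\<^sup>2 / (\<tau> * C_inv\<^sup>2) * ?N \<le> (dual_norm_L2 \<Omega> m Q \<delta>)\<^sup>2 / \<tau>"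
    using params by (simp add: field_simps power2_eq_square)
  moreover have "?N \<le> (C_P * l2_norm \<Omega> (weak_grad \<Omega> \<delta>))\<^sup>2"
    by (rule power_mono[OF poincare[OF \<delta>] l2_norm_nonneg])
  then have "\<gamma> * l * (?N / C_P\<^sup>2) \<le> \<gamma> * l * (l2_norm \<Omega> (weak_grad \<Omega> \<delta>))\<^sup>2"
    using params by (intro mult_left_mono) (auto simp: field_simps power_mult_distrib)
  moreover have "coercivity_ratio * (\<xi>\<^sup>2 * identity_modulus * ?N)
      = h\<^sup>2 / (\<tau> * C_inv\<^sup>2) * ?N + \<gamma> * l * (?N / C_P\<^sup>2)"
  proof -
    have "coercivity_ratio * (\<xi>\<^sup>2 * identity_modulus) = h\<^sup>2 / (\<tau> * C_inv\<^sup>2) + \<gamma> * l / C_P\<^sup>2"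
      using identity_modulus_pos params(4) by (simp add: coercivity_ratio_def)
    then show ?thesis by (simp add: mult.assoc[symmetric] distrib_right)
  qed
  ultimately show ?thesis by linarith
qed

lemma gradient_energy_on_segment:
  assumes "s \<in> Q" "s' \<in> Q"
  obtains b where "\<And>r. l2_inner \<Omega> (weak_grad \<Omega> (segment s s' r)) (weak_grad \<Omega> (segment s s' r))
    = l2_inner \<Omega> (weak_grad \<Omega> s) (weak_grad \<Omega> s) + 2 * b * r
      + (l2_norm \<Omega> (weak_grad \<Omega> (\<lambda>x. s' x - s x)))\<^sup>2 * r\<^sup>2"
proof -
  note H1 = Q_H1[OF assms(1)] Q_H1[OF assms(2)]
  define D where "D x = 1 *\<^sub>R weak_grad \<Omega> s' x + (-1) *\<^sub>R weak_grad \<Omega> s x" for x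
  have D: "D \<in> L2 \<Omega>" unfolding D_def[abs_def] using H1 by (intro L2_lincomb weak_grad_L2)
  have \<delta>: "(\<lambda>x. s' x - s x) \<in> H1 \<Omega>" using H1_lincomb[OF \<Omega> H1(2,1), of 1 "-1"] by simp
  have "(l2_norm \<Omega> (weak_grad \<Omega> (\<lambda>x. s' x - s x)))\<^sup>2 = l2_inner \<Omega> D D"
    unfolding l2_norm_power2
    using weak_grad_lincomb[OF \<Omega> H1(2,1), of 1 "-1"] D \<delta>
    by (intro l2_inner_cong_AE) (simp_all add: D_def weak_grad_L2)
  moreover have "l2_inner \<Omega> (weak_grad \<Omega> (segment s s' r)) (weak_grad \<Omega> (segment s s' r))
      = l2_inner \<Omega> (\<lambda>x. 1 *\<^sub>R weak_grad \<Omega> s x + r *\<^sub>R D x) (\<lambda>x. 1 *\<^sub>R weak_grad \<Omega> s x + r *\<^sub>R D x)" for r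
  proof -
    have "AE x in lebesgue_on \<Omega>. weak_grad \<Omega> (segment s s' r) x = 1 *\<^sub>R weak_grad \<Omega> s x + r *\<^sub>R D x"
      using weak_grad_lincomb[OF \<Omega> H1, of "1 - r" r]
      by eventually_elim (simp add: segment_def D_def algebra_simps)
    moreover have "weak_grad \<Omega> (segment s s' r) \<in> L2 \<Omega>"
      using assms by (intro weak_grad_L2 Q_H1 segment_Q)
    ultimately show ?thesis
      by (intro l2_inner_cong_AE L2_lincomb D weak_grad_L2[OF H1(1)])
  qed
  ultimately show ?thesis
    using psd_form_square[OF L2_lincomb_closed l2_inner_psd weak_grad_L2[OF H1(1)] D, of 1]
    by (intro that[of "l2_inner \<Omega> (weak_grad \<Omega> s) D"]) (simp add: algebra_simps)
qed

text \<open>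
  Moving the two components changes the elastic strain by \<open>t e - r p\<close>, where \<open>e\<close> is the strain
  increment and \<open>p\<close> the isotropic increment \<open>\<xi> (s' - s) I\<close>; the coefficient \<open>P\<close> is their inner
  product, and the only coupling between the two components.
\<close>

lemma elastic_energy_on_segments:
  assumes s: "s \<in> Q" "s' \<in> Q" and w: "w \<in> V" "w' \<in> V"
  obtains b1 b2 E P where
    "\<And>r t. elastic_form (elastic_strain (segment s s' r) (segment w w' t))
        (elastic_strain (segment s s' r) (segment w w' t))
      = elastic_form (elastic_strain s w) (elastic_strain s w) + 2 * b1 * r + 2 * b2 * t
        + (\<xi>\<^sup>2 * identity_modulus * (l2_norm \<Omega> (\<lambda>x. s' x - s x))\<^sup>2) * r\<^sup>2 - 2 * r * t * P + E * t\<^sup>2"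
    "\<And>r t. 0 \<le> (\<xi>\<^sup>2 * identity_modulus * (l2_norm \<Omega> (\<lambda>x. s' x - s x))\<^sup>2) * r\<^sup>2 - 2 * r * t * P + E * t\<^sup>2"
proof -
  note lc = sym_L2_lincomb_closed[of \<Omega>] and psd = elastic_psd
  define A where "A = elastic_strain s w"
  define e where "e x = 1 *\<^sub>R strain \<Omega> w' x + (-1) *\<^sub>R strain \<Omega> w x" for x
  define p where "p x = (\<xi> * (s' x - s x)) *\<^sub>R (mat 1 :: real^'d^'d)" for x
  have wH: "w \<in> H10_vec \<Omega>" "w' \<in> H10_vec \<Omega>" using w V(2) by auto
  have \<delta>: "(\<lambda>x. s' x - s x) \<in> L2 \<Omega>"
    using L2_lincomb[OF Q_L2[OF s(2)] Q_L2[OF s(1)], of 1 "-1"] by simp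
  have A: "A \<in> sym_L2 \<Omega>" unfolding A_def using s(1) w(1) by (rule elastic_strain_sym_L2)
  have e: "e \<in> sym_L2 \<Omega>"
    unfolding e_def[abs_def] by (intro lincomb_closedD[OF lc] strain_sym_L2 wH)
  have p: "p \<in> sym_L2 \<Omega>" unfolding p_def[abs_def] by (rule isotropic_sym_L2[OF \<delta>])
  have K: "elastic_form p p = \<xi>\<^sup>2 * identity_modulus * (l2_norm \<Omega> (\<lambda>x. s' x - s x))\<^sup>2"
  proof -
    have "\<C> (c *\<^sub>R M) = c *\<^sub>R \<C> M" for c M
      using elasticity by (simp add: elasticity_tensor_def linear_scale)
    then have "elastic_form p p
        = (LINT x|lebesgue_on \<Omega>. (\<xi>\<^sup>2 * identity_modulus) * ((s' x - s x) * (s' x - s x)))"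
      unfolding elastic_form_def l2_inner_def identity_modulus_def p_def
      by (intro arg_cong[where f = "integral\<^sup>L _"] ext)
         (simp add: inner_commute power2_eq_square)
    also have "\<dots> = \<xi>\<^sup>2 * identity_modulus * (l2_norm \<Omega> (\<lambda>x. s' x - s x))\<^sup>2"
      by (subst integral_mult_right_zero) (simp add: l2_norm_power2 l2_inner_def)
    finally show ?thesis .
  qed
  have expand: "elastic_form (elastic_strain (segment s s' r) (segment w w' t))
        (elastic_strain (segment s s' r) (segment w w' t))
      = elastic_form A A + 2 * (- elastic_form A p) * r + 2 * elastic_form A e * t
        + elastic_form p p * r\<^sup>2 - 2 * r * t * elastic_form e p + elastic_form e e * t\<^sup>2" for r t
  proof -
    define G where "G x = 1 *\<^sub>R A x + t *\<^sub>R e x" for x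
    have G: "G \<in> sym_L2 \<Omega>" unfolding G_def[abs_def] using A e by (rule lincomb_closedD[OF lc])
    have "AE x in lebesgue_on \<Omega>. elastic_strain (segment s s' r) (segment w w' t) x
        = 1 *\<^sub>R G x + (- r) *\<^sub>R p x"
      using strain_lincomb[OF \<Omega> wH, of "1 - t" t]
      by eventually_elim
        (simp add: elastic_strain_def G_def A_def e_def p_def segment_def algebra_simps)
    then have "elastic_form (elastic_strain (segment s s' r) (segment w w' t))
        (elastic_strain (segment s s' r) (segment w w' t))
      = elastic_form (\<lambda>x. 1 *\<^sub>R G x + (- r) *\<^sub>R p x) (\<lambda>x. 1 *\<^sub>R G x + (- r) *\<^sub>R p x)"
      using s w G p
      by (intro elastic_form_cong_AE sym_L2_L2 elastic_strain_sym_L2 segment_Q segment_V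
          lincomb_closedD[OF lc])
    also have "\<dots> = elastic_form G G - 2 * r * elastic_form G p + r\<^sup>2 * elastic_form p p"
      by (simp only: psd_form_square[OF lc psd G p]) simp
    also have "elastic_form G G = elastic_form A A + 2 * t * elastic_form A e + t\<^sup>2 * elastic_form e e"
      unfolding G_def[abs_def] by (simp only: psd_form_square[OF lc psd A e]) simp
    also have "elastic_form G p = elastic_form A p + t * elastic_form e p"
      using psd_form_lincomb_left[OF psd A e p, of 1 t] by (simp add: G_def[abs_def])
    finally show ?thesis by (simp add: algebra_simps)
  qed
  have nonneg: "0 \<le> elastic_form p p * r\<^sup>2 - 2 * r * t * elastic_form e p + elastic_form e e * t\<^sup>2" for r t
    using psd_form_nonneg[OF psd lincomb_closedD[OF lc e p, of t "- r"]]
    by (simp only: psd_form_square[OF lc psd e p]) (simp add: algebra_simps)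
  show ?thesis
    by (rule that[of "- elastic_form A p" "elastic_form A e" "elastic_form e p" "elastic_form e e"])
       (use expand nonneg in \<open>simp_all only: K A_def\<close>)
qed

text \<open>
  Every part of the energy other than the integral of \<open>\<Psi>c\<close> is a quadratic polynomial in \<open>r\<close>
  and \<open>t\<close>.  The function \<open>g\<close> collects that integral with all terms that are constant or linear in
  \<open>r\<close>.
\<close>

lemma step_energy_on_segments:
  assumes s: "s \<in> Qb" "s' \<in> Qb" and w: "w \<in> V" "w' \<in> V"
  obtains g c2 X E P K where
    "scalar_energy (\<lambda>r t. H (segment s s' r) (segment w w' t)) g c2 X E P K coercivity_ratio"
proof -
  define \<delta> where "\<delta> = (\<lambda>x. s' x - s x)"
  have sQ: "s \<in> Q" "s' \<in> Q" using s by (simp_all add: Qbar_Q)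
  have \<delta>: "\<delta> \<in> mean_zero \<Omega> Q" unfolding \<delta>_def using s by (rule Qbar_diff_mean_zero)
  define s0 where "s0 = (\<lambda>x. s x - \<phi>prev x - \<tau> * R x)"
  have "s0 \<in> L2 \<Omega>"
    using L2_lincomb[OF L2_lincomb[OF Q_L2[OF sQ(1)] Q_L2[OF data(3)], of 1 "-1"] data(1), of 1 "- \<tau>"]
    by (simp add: s0_def)
  then obtain b where b: "\<And>r. (dual_norm_L2 \<Omega> m Q (\<lambda>x. s0 x + r * \<delta> x))\<^sup>2
      = (dual_norm_L2 \<Omega> m Q s0)\<^sup>2 + 2 * b * r + r\<^sup>2 * (dual_norm_L2 \<Omega> m Q \<delta>)\<^sup>2"
    using dual_norm_L2_power2_quadratic[OF _ Q_L2[OF mean_zero_Q[OF \<delta>]]] by blast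
  have dual: "(dual_norm_L2 \<Omega> m Q (\<lambda>x. segment s s' r x - \<phi>prev x - \<tau> * R x))\<^sup>2
      = (dual_norm_L2 \<Omega> m Q s0)\<^sup>2 + 2 * b * r + r\<^sup>2 * (dual_norm_L2 \<Omega> m Q \<delta>)\<^sup>2" for r
  proof -
    have "(\<lambda>x. segment s s' r x - \<phi>prev x - \<tau> * R x) = (\<lambda>x. s0 x + r * \<delta> x)"
      by (simp add: segment_def s0_def \<delta>_def fun_eq_iff algebra_simps)
    then show ?thesis by (simp only: b)
  qed
  obtain b' where grad: "\<And>r. l2_inner \<Omega> (weak_grad \<Omega> (segment s s' r)) (weak_grad \<Omega> (segment s s' r))
    = l2_inner \<Omega> (weak_grad \<Omega> s) (weak_grad \<Omega> s) + 2 * b' * r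
      + (l2_norm \<Omega> (weak_grad \<Omega> \<delta>))\<^sup>2 * r\<^sup>2"
    unfolding \<delta>_def by (rule gradient_energy_on_segment[OF sQ]) blast
  define K where "K = \<xi>\<^sup>2 * identity_modulus * (l2_norm \<Omega> \<delta>)\<^sup>2"
  obtain b1 b2 E P where el:
    "\<And>r t. elastic_form (elastic_strain (segment s s' r) (segment w w' t))
        (elastic_strain (segment s s' r) (segment w w' t))
      = elastic_form (elastic_strain s w) (elastic_strain s w) + 2 * b1 * r + 2 * b2 * t
        + K * r\<^sup>2 - 2 * r * t * P + E * t\<^sup>2"
    and coupling: "\<And>r t. 0 \<le> K * r\<^sup>2 - 2 * r * t * P + E * t\<^sup>2"
    unfolding K_def \<delta>_def by (rule elastic_energy_on_segments[OF sQ w]) blast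
  have source: "l2_inner \<Omega> (\<lambda>x. deriv \<Psi>e (\<phi>prev x)) (segment s s' r)
      = (1 - r) * l2_inner \<Omega> (\<lambda>x. deriv \<Psi>e (\<phi>prev x)) s
        + r * l2_inner \<Omega> (\<lambda>x. deriv \<Psi>e (\<phi>prev x)) s'" (is "_ = (1 - r) * ?ls + r * ?ls'") for r
    unfolding segment_def by (intro l2_inner_lincomb_right Q_L2 sQ deriv_\<Psi>e_L2)
  have load: "l2_inner \<Omega> f (segment w w' t) = (1 - t) * l2_inner \<Omega> f w + t * l2_inner \<Omega> f w'" for t
    unfolding segment_def using w V(2) by (intro l2_inner_lincomb_right H10_vec_L2 data) auto
  define X where "X = (dual_norm_L2 \<Omega> m Q \<delta>)\<^sup>2 / \<tau> + \<gamma> * l * (l2_norm \<Omega> (weak_grad \<Omega> \<delta>))\<^sup>2"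
  define I where "I r = (LINT x|lebesgue_on \<Omega>. \<Psi>c (segment s s' r x))" for r
  define a0 where "a0 = (dual_norm_L2 \<Omega> m Q s0)\<^sup>2 / (2 * \<tau>)
      + \<gamma> * l / 2 * l2_inner \<Omega> (weak_grad \<Omega> s) (weak_grad \<Omega> s)
      + elastic_form (elastic_strain s w) (elastic_strain s w) / 2 - \<gamma> / l * ?ls - l2_inner \<Omega> f w"
  define a1 where "a1 = b / \<tau> + \<gamma> * l * b' + b1 - \<gamma> / l * (?ls' - ?ls)"
  define g where "g r = a0 + a1 * r + \<gamma> / l * I r" for r
  define c2 where "c2 = b2 - (l2_inner \<Omega> f w' - l2_inner \<Omega> f w)"
  have "scalar_energy (\<lambda>r t. H (segment s s' r) (segment w w' t)) g c2 X E P K coercivity_ratio"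
  proof
    fix r t
    have "H (segment s s' r) (segment w w' t)
      = ((dual_norm_L2 \<Omega> m Q s0)\<^sup>2 + 2 * b * r + r\<^sup>2 * (dual_norm_L2 \<Omega> m Q \<delta>)\<^sup>2) / (2 * \<tau>)
        + (\<gamma> / l * I r + \<gamma> * l / 2 * (l2_inner \<Omega> (weak_grad \<Omega> s) (weak_grad \<Omega> s) + 2 * b' * r
              + (l2_norm \<Omega> (weak_grad \<Omega> \<delta>))\<^sup>2 * r\<^sup>2)
           + 1 / 2 * (elastic_form (elastic_strain s w) (elastic_strain s w) + 2 * b1 * r + 2 * b2 * t
              + K * r\<^sup>2 - 2 * r * t * P + E * t\<^sup>2))
        - \<gamma> / l * ((1 - r) * ?ls + r * ?ls') - ((1 - t) * l2_inner \<Omega> f w + t * l2_inner \<Omega> f w')"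
      unfolding step_energy_def energy_c_eq[OF segment_Q[OF sQ] segment_V[OF w]] dual grad el source
        load I_def ..
    also have "\<dots> = g r + c2 * t + (X * r\<^sup>2 + E * t\<^sup>2 - 2 * r * t * P + K * r\<^sup>2) / 2"
      by (simp add: g_def c2_def X_def a0_def a1_def add_divide_distrib diff_divide_distrib
          algebra_simps)
    finally show "H (segment s s' r) (segment w w' t)
      = g r + c2 * t + (X * r\<^sup>2 + E * t\<^sup>2 - 2 * r * t * P + K * r\<^sup>2) / 2" .
  next
    fix r :: real assume r: "0 \<le> r" "r \<le> 1"
    have "\<gamma> / l * I r \<le> \<gamma> / l * ((1 - r) * I 0 + r * I 1)"
      using potential_convex_on_segment[OF sQ r] params by (intro mult_left_mono) (auto simp: I_def)
    then show "g r \<le> (1 - r) * g 0 + r * g 1"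
      by (simp add: g_def algebra_simps diff_divide_distrib)
  next
    show "coercivity_ratio * K \<le> X" unfolding K_def X_def by (rule chemical_coercivity[OF \<delta>])
  qed (rule coupling coercivity_ratio_pos)+
  then show ?thesis by (rule that)
qed

text \<open>
  The new phase field does at least as well as the point at parameter \<open>b\<close> on the segment towards
  \<open>s'\<close>, and the new displacement at least as well as the corresponding point on the segment
  towards \<open>w'\<close>.
\<close>

lemma alternating_step_contraction:
  assumes s: "s \<in> Qb" "s' \<in> Qb" and w: "w \<in> V" "w' \<in> V"
    and w_opt: "\<And>v. v \<in> V \<Longrightarrow> H s w \<le> H s v"
    and s1: "s1 \<in> Qb" "\<And>q. q \<in> Qb \<Longrightarrow> H s1 w \<le> H q w"
    and w1: "\<And>v. v \<in> V \<Longrightarrow> H s1 w1 \<le> H s1 v"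
    and b: "b = coercivity_ratio / (1 + coercivity_ratio)"
  shows "H s1 w1 - H s' w' \<le> (1 - b) * (1 - b) * (H s w - H s' w')"
proof -
  have b1: "0 \<le> 1 - b" using coercivity_ratio_pos by (simp add: b)
  obtain g c2 X E P K where
    first: "scalar_energy (\<lambda>r t. H (segment s s' r) (segment w w' t)) g c2 X E P K coercivity_ratio"
    by (rule step_energy_on_segments[OF s w])
  have "H s1 w \<le> H (segment s s' b) w" by (intro s1 segment_Qbar s)
  also have "H (segment s s' b) w - H s' w' \<le> (1 - b) * (H s w - H s' w')"
    using scalar_energy.contraction_first_variable[OF first _ b] w_opt[OF segment_V[OF w]] by simp
  finally have half: "H s1 w - H s' w' \<le> (1 - b) * (H s w - H s' w')" by simp
  obtain g c2 X E P K where
    second: "scalar_energy (\<lambda>r t. H (segment s1 s' r) (segment w w' t)) g c2 X E P K coercivity_ratio"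
    by (rule step_energy_on_segments[OF s1(1) s(2) w])
  have "H s1 w1 \<le> H s1 (segment w w' b)" by (intro w1 segment_V w)
  also have "H s1 (segment w w' b) - H s' w' \<le> (1 - b) * (H s1 w - H s' w')"
    using scalar_energy.contraction_second_variable[OF second _ b] s1(2)[OF segment_Qbar[OF s1(1) s(2)]]
    by simp
  finally have "H s1 w1 - H s' w' \<le> (1 - b) * (H s1 w - H s' w')" by simp
  also have "\<dots> \<le> (1 - b) * ((1 - b) * (H s w - H s' w'))"
    using half b1 by (rule mult_left_mono)
  finally show ?thesis by (simp add: mult.assoc)
qed

end

section \<open>Linear convergence\<close>

theorem theorem2:
  fixes \<Omega> :: "(real^'d) set"
    and T :: "(real^'d) set set"
    and Qh :: "(real^'d \<Rightarrow> real) set"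
    and Vh :: "(real^'d \<Rightarrow> real^'d) set"
    and h \<gamma> l \<tau> m \<xi> C_inv C_Om L_\<Psi>c \<beta>_ch \<beta>_e L_ch :: real
    and R \<phi>_prev \<phi>_n :: "real^'d \<Rightarrow> real"
    and f u_prev u_n :: "real^'d \<Rightarrow> real^'d"
    and \<Psi> \<Psi>c \<Psi>e :: "real \<Rightarrow> real"
    and \<C> :: "real^'d^'d \<Rightarrow> real^'d^'d"
    and H :: "(real^'d \<Rightarrow> real) \<Rightarrow> (real^'d \<Rightarrow> real^'d) \<Rightarrow> real"
    and Qb :: "(real^'d \<Rightarrow> real) set"
    and \<phi> :: "nat \<Rightarrow> real^'d \<Rightarrow> real"
    and u :: "nat \<Rightarrow> real^'d \<Rightarrow> real^'d"
  assumes domain: "bounded_lipschitz_domain \<Omega>"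
    and mesh: "mesh_of \<Omega> T" "h = mesh_diameter T" "h > 0"
    and Qh: "fe_space T Qh" "Qh \<subseteq> H1 \<Omega>" "contains_constants \<Omega> Qh"
    and Vh: "fe_space T Vh" "Vh \<subseteq> H10_vec \<Omega>"
    and params: "\<gamma> > 0" "l > 0" "\<tau> > 0" "m > 0" "\<xi> \<noteq> 0"
    and data: "R \<in> L2 \<Omega>" "f \<in> L2 \<Omega>"
    and inverse_estimate: "C_inv > 0"
      "\<And>s. s \<in> mean_zero \<Omega> Qh \<Longrightarrow> C_inv * inverse h * dual_norm_L2 \<Omega> m Qh s \<ge> l2_norm \<Omega> s"
    and poincare: "C_Om > 0"
      "\<And>s. s \<in> mean_zero \<Omega> Qh \<Longrightarrow> l2_norm \<Omega> s \<le> C_Om * l2_norm \<Omega> (weak_grad \<Omega> s)"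
    and double_well: "\<And>a. \<Psi> a = \<Psi>c a - \<Psi>e a"
      "convex_on UNIV \<Psi>c" "\<And>a. \<Psi>c differentiable (at a)"
      "convex_on UNIV \<Psi>e" "\<And>a. \<Psi>e differentiable (at a)"
      "\<And>a b. (deriv \<Psi>c a - deriv \<Psi>c b) * (a - b) \<le> L_\<Psi>c * (a - b)\<^sup>2"
    and elasticity: "elasticity_tensor \<Omega> \<C>"
    and prev: "\<phi>_prev \<in> Qh" "u_prev \<in> Vh"
    and H_eq: "H = step_energy \<Omega> Qh \<gamma> l \<tau> m \<xi> \<C> \<Psi>c \<Psi>e R f \<phi>_prev"
    and Qb_eq: "Qb = Qbar \<Omega> Qh \<tau> R \<phi>_prev"
    and minimizer: "is_arg_min (\<lambda>(s, w). H s w) (\<lambda>(s, w). s \<in> Qb \<and> w \<in> Vh) (\<phi>_n, u_n)"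
    and init: "\<phi> 0 = \<phi>_prev" "u 0 = u_prev"
    and step_\<phi>: "\<And>i. i \<ge> 1 \<Longrightarrow> is_arg_min (\<lambda>s. H s (u (i - 1))) (\<lambda>s. s \<in> Qb) (\<phi> i)"
    and step_u: "\<And>i. i \<ge> 1 \<Longrightarrow> is_arg_min (\<lambda>w. H (\<phi> i) w) (\<lambda>w. w \<in> Vh) (u i)"
    and \<beta>_ch_eq: "\<beta>_ch = 1 - inverse (h\<^sup>2 / (\<tau> * C_inv\<^sup>2 * \<xi>\<^sup>2 * (mat 1 \<bullet> \<C> (mat 1)))
                              + \<gamma> * l / (C_Om\<^sup>2 * \<xi>\<^sup>2 * (mat 1 \<bullet> \<C> (mat 1))) + 1)"
    and \<beta>_e_eq: "\<beta>_e = \<beta>_ch"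
    and L_ch_eq: "L_ch = 1 + L_\<Psi>c * inverse (h\<^sup>2 / (\<tau> * C_inv\<^sup>2) + \<gamma> * l / C_Om\<^sup>2
                              + \<xi>\<^sup>2 * (mat 1 \<bullet> \<C> (mat 1)))"
  shows "\<forall>i\<ge>1. (i = 1 \<longrightarrow> \<phi>_prev \<in> Qb \<and> is_arg_min (\<lambda>w. H \<phi>_prev w) (\<lambda>w. w \<in> Vh) u_prev) \<longrightarrow>
           H (\<phi> i) (u i) - H \<phi>_n u_n
             \<le> (1 - \<beta>_ch / L_ch) * (1 - \<beta>_e) * (H (\<phi> (i - 1)) (u (i - 1)) - H \<phi>_n u_n)"
proof (intro allI impI)
  fix i :: nat
  assume i: "i \<ge> 1"
    and first: "i = 1 \<longrightarrow> \<phi>_prev \<in> Qb \<and> is_arg_min (\<lambda>w. H \<phi>_prev w) (\<lambda>w. w \<in> Vh) u_prev"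
  obtain B where B: "finite B" "Qh = fun_span B" using Qh(1) by (auto simp: fe_space_def)
  have \<Omega>: "open \<Omega>" "bounded \<Omega>" "\<Omega> \<noteq> {}" using domain by (auto simp: bounded_lipschitz_domain_def)
  interpret cahn_larche_step \<Omega> Qh B m C_Om T Vh \<gamma> l \<tau> \<xi> C_inv h \<C> \<Psi>c \<Psi>e R \<phi>_prev f
  proof
    show "lincomb_closed Vh" using Vh(1) by (auto simp: fe_space_def fun_span_lincomb_closed)
    show "piecewise_polynomial T s" if "s \<in> Qh" for s using Qh(1) that by (simp add: fe_space_def)
  qed (fact \<Omega> params B Qh(2) poincare mesh Vh(2) inverse_estimate data prev double_well elasticity)+
  define b where "b = coercivity_ratio / (1 + coercivity_ratio)"
  have c: "coercivity_ratio > 0" by (rule coercivity_ratio_pos)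
  have "h\<^sup>2 / (\<tau> * C_inv\<^sup>2 * \<xi>\<^sup>2 * (mat 1 \<bullet> \<C> (mat 1))) + \<gamma> * l / (C_Om\<^sup>2 * \<xi>\<^sup>2 * (mat 1 \<bullet> \<C> (mat 1)))
      = coercivity_ratio"
    by (simp add: coercivity_ratio_def identity_modulus_def add_divide_distrib mult.assoc)
  then have \<beta>: "\<beta>_ch = b" "\<beta>_e = b"
    using c by (simp_all add: \<beta>_ch_eq \<beta>_e_eq b_def field_simps)
  have b01: "0 \<le> b" "b \<le> 1" using c by (simp_all add: b_def)
  have L: "1 \<le> L_ch"
  proof -
    have "0 \<le> deriv \<Psi>c 1 - deriv \<Psi>c 0"
      using convex_differentiable_imp_mono_deriv[OF double_well(2,3)] by (simp add: mono_def)
    then have "0 \<le> L_\<Psi>c" using double_well(6)[of 1 0] by simp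
    moreover have "0 \<le> h\<^sup>2 / (\<tau> * C_inv\<^sup>2) + \<gamma> * l / C_Om\<^sup>2 + \<xi>\<^sup>2 * (mat 1 \<bullet> \<C> (mat 1))"
      using params identity_modulus_pos by (simp add: identity_modulus_def)
    ultimately show ?thesis by (simp add: L_ch_eq)
  qed
  have prev_opt: "\<phi> (i - 1) \<in> Qb \<and> is_arg_min (\<lambda>w. H (\<phi> (i - 1)) w) (\<lambda>w. w \<in> Vh) (u (i - 1))"
  proof (cases "i = 1")
    case True
    then show ?thesis using first init by simp
  next
    case False
    then show ?thesis
      using i step_\<phi>[of "i - 1"] step_u[of "i - 1"] by (auto simp: is_arg_min_def)
  qed
  have min: "\<phi>_n \<in> Qb" "u_n \<in> Vh" "H \<phi>_n u_n \<le> H (\<phi> (i - 1)) (u (i - 1))"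
    using minimizer prev_opt by (auto simp: is_arg_min_linorder)
  have "H (\<phi> i) (u i) - H \<phi>_n u_n
      \<le> (1 - b) * (1 - b) * (H (\<phi> (i - 1)) (u (i - 1)) - H \<phi>_n u_n)"
    using alternating_step_contraction[OF _ _ _ _ _ _ _ _ b_def, of "\<phi> (i - 1)" \<phi>_n "u (i - 1)" u_n "\<phi> i" "u i"]
      prev_opt min step_\<phi>[OF i] step_u[OF i]
    by (simp add: H_eq Qb_eq is_arg_min_linorder)
  also have "\<dots> \<le> (1 - b / L_ch) * (1 - b) * (H (\<phi> (i - 1)) (u (i - 1)) - H \<phi>_n u_n)"
  proof -
    have "b / L_ch \<le> b" using L b01 by (simp add: divide_le_eq mult_le_cancel_left1)
    then show ?thesis using b01 min(3) by (intro mult_right_mono) auto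
  qed
  finally show "H (\<phi> i) (u i) - H \<phi>_n u_n
      \<le> (1 - \<beta>_ch / L_ch) * (1 - \<beta>_e) * (H (\<phi> (i - 1)) (u (i - 1)) - H \<phi>_n u_n)"
    by (simp only: \<beta>)
qed

end
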